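(* Let $\mathcal H$ be a class of continuous maps of topological spaces satisfying axioms (0)–(4) listed in the context and, in addition, the classical 2-out-of-3 axiom $(2^+)$: for composable maps $f,g$, if any two of $f,g,gf$ lie in $\mathcal H$ then so does the third. Then every strong $\mathcal H$-fibration is a universal $\mathcal H$-fibration.
   Context: For a map $p:E\to B$ and $b\in B$, $\mathrm{fib}_b\,p=p^{-1}(b)$ is the topological fibre and $\mathrm{hofib}_b\,p=E\times_B \mathrm{map}_*(I,B)$ is the homotopy fibre (pairs of a point $e\in E$ and a path in $B$ connecting $b$ with $p(e)$); $\mathrm{fib}_b\,p\to\mathrm{hofib}_b\,p$ is the canonical inclusion via constant paths. Axioms on the class $\mathcal H$ of continuous maps: (0) $\mathcal H$ contains all weak homotopy equivalences. (1) $\mathcal H$ is closed under retracts. (2) For composable maps $X\xrightarrow{f}Y\xrightarrow{g}Z$: if $f\in\mathcal H$ then $g\in\mathcal H\Leftrightarrow gf\in\mathcal H$; if $g$ is a weak equivalence then $f\in\mathcal H\Leftrightarrow gf\in\mathcal H$. (3) If $p':E'\to B$ and $p:E\to B$ are maps and $E'\to E$ is a map over $B$ such that all canonical maps $\mathrm{hofib}_b\,p'\to\mathrm{hofib}_b\,p$, $b\in B$, lie in $\mathcal H$, then $E'\to E$ lies in $\mathcal H$. (4) If $\mathcal I$ is a (small) category with contractible classifying space $B\mathcal I$ and $D:\mathcal I\to\mathrm{Top}$ is a diagram sending every morphism of $\mathcal I$ to a map in $\mathcal H$, then all structure maps $D i\to\mathrm{hocolim}\,D$ lie in $\mathcal H$.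 A map $p:E\to B$ is an $\mathcal H$-fibration if for all $b\in B$ the canonical inclusion $\mathrm{fib}_b\,p\to\mathrm{hofib}_b\,p$ is in $\mathcal H$. It is a universal $\mathcal H$-fibration if for every $n\geq 0$ and every map $\sigma:D^n\to B$ from a disc the pullback $\sigma^*E\to D^n$ of $p$ along $\sigma$ is an $\mathcal H$-fibration. A path-lifting map for $p:E\to B$ is a continuous map $\ell:E\times_B\mathrm{map}(I,B)\to E$, where $\mathrm{map}(I,B)$ is a space over $B$ via evaluation at $0$, such that $\ell(-,\gamma)$ maps $p^{-1}(\gamma(0))$ to $p^{-1}(\gamma(1))$ for each path $\gamma$. Its unit map is $u:E\to E$, $u(e)=\ell(e,\underline{p(e)})$, where $\underline{p(e)}$ is the constant path at $p(e)$. A path-lifting map for $p$ induces one on any pullback $g^*E=B'\times_BE\to B'$ along $g:B'\to B$, by $((b',e),\gamma')\mapsto(\gamma'(1),\ell(e,g\circ\gamma'))$. A path-lifting map $\ell$ is an $\mathcal H$-path-lifting map if $u\in\mathcal H$; it is a universal $\mathcal H$-path-lifting map if the induced path-lifting map on the pullback of $p$ along any map $D^n\to B$ is an $\mathcal H$-path-lifting map. A map $p:E\to B$ is a strong $\mathcal H$-fibration if it admits a universal $\mathcal H$-path-lifting map. *)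

theory Defs
  imports "HOL-Analysis.Analysis" "HOL-Homology.Simplices"
begin

section \<open>Weak homotopy equivalences\<close>

definition cube :: "nat \<Rightarrow> (nat \<Rightarrow> real) topology" where
  "cube n = product_topology (\<lambda>_. top_of_set {0..1}) {..<n}"

definition cube_boundary :: "nat \<Rightarrow> (nat \<Rightarrow> real) set" where
  "cube_boundary n = {s \<in> topspace (cube n). \<exists>i<n. s i = 0 \<or> s i = 1}"

definition spheroids :: "nat \<Rightarrow> 'a topology \<Rightarrow> 'a \<Rightarrow> ((nat \<Rightarrow> real) \<Rightarrow> 'a) set" where
  "spheroids n X x = {g. continuous_map (cube n) X g \<and> g ` cube_boundary n \<subseteq> {x}}"

definition spheroid_class ::
  "nat \<Rightarrow> 'a topology \<Rightarrow> 'a \<Rightarrow> ((nat \<Rightarrow> real) \<Rightarrow> 'a) \<Rightarrow> ((nat \<Rightarrow> real) \<Rightarrow> 'a) set" where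
  "spheroid_class n X x g =
     {h \<in> spheroids n X x. homotopic_with (\<lambda>k. k ` cube_boundary n \<subseteq> {x}) (cube n) X g h}"

text \<open>The underlying set of the \<open>n\<close>-th homotopy group. The group structure is not needed:
  for \<open>n \<ge> 1\<close> induced maps are automatically homomorphisms, so they are isomorphisms iff they are
  bijective.\<close>

definition homotopy_group :: "nat \<Rightarrow> 'a topology \<Rightarrow> 'a \<Rightarrow> ((nat \<Rightarrow> real) \<Rightarrow> 'a) set set" where
  "homotopy_group n X x = spheroid_class n X x ` spheroids n X x"

definition induced_on_homotopy_group ::
  "nat \<Rightarrow> 'b topology \<Rightarrow> ('a \<Rightarrow> 'b) \<Rightarrow> 'a \<Rightarrow> ((nat \<Rightarrow> real) \<Rightarrow> 'a) set \<Rightarrow> ((nat \<Rightarrow> real) \<Rightarrow> 'b) set" where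
  "induced_on_homotopy_group n Y f x C = (\<Union>g\<in>C. spheroid_class n Y (f x) (f \<circ> g))"

definition weak_homotopy_equivalence :: "'a topology \<Rightarrow> 'b topology \<Rightarrow> ('a \<Rightarrow> 'b) \<Rightarrow> bool" where
  "weak_homotopy_equivalence X Y f \<longleftrightarrow>
     continuous_map X Y f \<and>
     bij_betw (\<lambda>C. \<Union>x\<in>C. path_component_of_set Y (f x)) (path_components_of X) (path_components_of Y) \<and>
     (\<forall>n\<ge>1. \<forall>x\<in>topspace X.
        bij_betw (induced_on_homotopy_group n Y f x) (homotopy_group n X x) (homotopy_group n Y (f x)))"


section \<open>Path spaces, fibres, pullbacks\<close>

text \<open>Paths are made extensional so that two paths are equal iff they agree on the unit interval;
  the topology is the compact-open topology. (The subbasic set for \<open>K = {}\<close>, \<open>U = {}\<close> is the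
  whole space.)\<close>

definition paths :: "'b topology \<Rightarrow> (real \<Rightarrow> 'b) set" where
  "paths B = {\<gamma>. pathin B \<gamma>} \<inter> extensional {0..1}"

definition path_space :: "'b topology \<Rightarrow> (real \<Rightarrow> 'b) topology" where
  "path_space B = topology_generated_by
     {{\<gamma> \<in> paths B. \<gamma> ` K \<subseteq> U} | K U. compact K \<and> K \<subseteq> {0..1} \<and> openin B U}"

definition const_path :: "'b \<Rightarrow> real \<Rightarrow> 'b" where
  "const_path b = restrict (\<lambda>_. b) {0..1}"

definition fib :: "'e topology \<Rightarrow> ('e \<Rightarrow> 'b) \<Rightarrow> 'b \<Rightarrow> 'e topology" where
  "fib E p b = subtopology E {e. p e = b}"

definition hofib :: "'e topology \<Rightarrow> 'b topology \<Rightarrow> ('e \<Rightarrow> 'b) \<Rightarrow> 'b \<Rightarrow> ('e \<times> (real \<Rightarrow> 'b)) topology" where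
  "hofib E B p b = subtopology (prod_topology E (path_space B)) {(e, \<gamma>). \<gamma> 0 = b \<and> \<gamma> 1 = p e}"

definition fib_to_hofib :: "'b \<Rightarrow> 'e \<Rightarrow> 'e \<times> (real \<Rightarrow> 'b)" where
  "fib_to_hofib b e = (e, const_path b)"

definition pullback :: "'c topology \<Rightarrow> 'e topology \<Rightarrow> ('c \<Rightarrow> 'b) \<Rightarrow> ('e \<Rightarrow> 'b) \<Rightarrow> ('c \<times> 'e) topology" where
  "pullback B' E g p = subtopology (prod_topology B' E) {(b', e). g b' = p e}"

definition disc :: "nat \<Rightarrow> (nat \<Rightarrow> real) topology" where
  "disc n = subtopology (Euclidean_space n) {x. (\<Sum>i<n. (x i)\<^sup>2) \<le> 1}"


section \<open>Geometric realisation\<close>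

definition quotient_space :: "'a topology \<Rightarrow> ('a \<times> 'a) set \<Rightarrow> 'a set topology" where
  "quotient_space Z r =
     topology (\<lambda>U. U \<subseteq> topspace Z // r \<and> openin Z {z \<in> topspace Z. r `` {z} \<in> U})"

lemma openin_quotient_space:
  "openin (quotient_space Z r) U \<longleftrightarrow>
     U \<subseteq> topspace Z // r \<and> openin Z {z \<in> topspace Z. r `` {z} \<in> U}"
proof -
  have "istopology (\<lambda>U. U \<subseteq> topspace Z // r \<and> openin Z {z \<in> topspace Z. r `` {z} \<in> U})"
    unfolding istopology_def
  proof (intro conjI allI impI)
    fix S T
    assume "S \<subseteq> topspace Z // r \<and> openin Z {z \<in> topspace Z. r `` {z} \<in> S}"
      and "T \<subseteq> topspace Z // r \<and> openin Z {z \<in> topspace Z. r `` {z} \<in> T}"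
    moreover have "{z \<in> topspace Z. r `` {z} \<in> S \<inter> T} =
        {z \<in> topspace Z. r `` {z} \<in> S} \<inter> {z \<in> topspace Z. r `` {z} \<in> T}"
      by auto
    ultimately show "S \<inter> T \<subseteq> topspace Z // r" "openin Z {z \<in> topspace Z. r `` {z} \<in> S \<inter> T}"
      by (auto simp: openin_Int)
  next
    fix K
    assume K: "\<forall>S\<in>K. S \<subseteq> topspace Z // r \<and> openin Z {z \<in> topspace Z. r `` {z} \<in> S}"
    have "{z \<in> topspace Z. r `` {z} \<in> \<Union>K} = (\<Union>S\<in>K. {z \<in> topspace Z. r `` {z} \<in> S})"
      by auto
    with K show "\<Union>K \<subseteq> topspace Z // r" "openin Z {z \<in> topspace Z. r `` {z} \<in> \<Union>K}"
      by auto
  qed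
  then show ?thesis
    by (simp add: quotient_space_def topology_inverse')
qed

text \<open>A simplicial space is given by spaces \<open>X n\<close> and, for each monotone
  \<open>\<theta> : {..m} \<rightarrow> {..n}\<close>, the operator \<open>act m \<theta>\<close> from \<open>X n\<close> to \<open>X m\<close>. Its realisation is the
  quotient of the disjoint union of the \<open>X n \<times> \<Delta>\<^sup>n\<close> by \<open>(act m \<theta> x, t) \<sim> (x, \<theta>\<^sub>* t)\<close>.\<close>

definition simplex_space :: "nat \<Rightarrow> (nat \<Rightarrow> real) topology" where
  "simplex_space n = subtopology (powertop_real UNIV) (standard_simplex n)"

definition simplex_push :: "nat \<Rightarrow> (nat \<Rightarrow> nat) \<Rightarrow> (nat \<Rightarrow> real) \<Rightarrow> nat \<Rightarrow> real" where
  "simplex_push m \<theta> t = (\<lambda>j. \<Sum>i\<in>{i. i \<le> m \<and> \<theta> i = j}. t i)"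

definition realization_total :: "(nat \<Rightarrow> 'a topology) \<Rightarrow> (nat \<times> ('a \<times> (nat \<Rightarrow> real))) topology" where
  "realization_total X = sum_topology (\<lambda>n. prod_topology (X n) (simplex_space n)) UNIV"

definition realization_rel ::
  "(nat \<Rightarrow> 'a topology) \<Rightarrow> (nat \<Rightarrow> (nat \<Rightarrow> nat) \<Rightarrow> 'a \<Rightarrow> 'a)
     \<Rightarrow> ((nat \<times> ('a \<times> (nat \<Rightarrow> real))) \<times> (nat \<times> ('a \<times> (nat \<Rightarrow> real)))) set" where
  "realization_rel X act =
     (let r = {((m, (act m \<theta> x, t)), (n, (x, simplex_push m \<theta> t))) | m n \<theta> x t.
                 mono_on {..m} \<theta> \<and> \<theta> ` {..m} \<subseteq> {..n} \<and>
                 x \<in> topspace (X n) \<and> t \<in> standard_simplex m}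
      in (r \<union> r\<inverse>)\<^sup>*)"

definition realization ::
  "(nat \<Rightarrow> 'a topology) \<Rightarrow> (nat \<Rightarrow> (nat \<Rightarrow> nat) \<Rightarrow> 'a \<Rightarrow> 'a)
     \<Rightarrow> (nat \<times> ('a \<times> (nat \<Rightarrow> real))) set topology" where
  "realization X act = quotient_space (realization_total X) (realization_rel X act)"


section \<open>Categories, classifying spaces, homotopy colimits\<close>

record ('o, 'm) cat =
  Ob :: "'o set"
  Ar :: "'m set"
  src :: "'m \<Rightarrow> 'o"
  tgt :: "'m \<Rightarrow> 'o"
  ide :: "'o \<Rightarrow> 'm"
  cmp :: "'m \<Rightarrow> 'm \<Rightarrow> 'm"

text \<open>\<open>cmp C g f\<close> is \<open>g\<close> after \<open>f\<close>.\<close>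

definition category :: "('o, 'm) cat \<Rightarrow> bool" where
  "category C \<longleftrightarrow>
     (\<forall>f\<in>Ar C. src C f \<in> Ob C \<and> tgt C f \<in> Ob C) \<and>
     (\<forall>a\<in>Ob C. ide C a \<in> Ar C \<and> src C (ide C a) = a \<and> tgt C (ide C a) = a) \<and>
     (\<forall>f\<in>Ar C. \<forall>g\<in>Ar C. tgt C f = src C g \<longrightarrow>
        cmp C g f \<in> Ar C \<and> src C (cmp C g f) = src C f \<and> tgt C (cmp C g f) = tgt C g) \<and>
     (\<forall>f\<in>Ar C. cmp C f (ide C (src C f)) = f \<and> cmp C (ide C (tgt C f)) f = f) \<and>
     (\<forall>f\<in>Ar C. \<forall>g\<in>Ar C. \<forall>h\<in>Ar C. tgt C f = src C g \<and> tgt C g = src C h \<longrightarrow>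
        cmp C h (cmp C g f) = cmp C (cmp C h g) f)"

definition diagram ::
  "('o, 'm) cat \<Rightarrow> ('o \<Rightarrow> 'a topology) \<Rightarrow> ('m \<Rightarrow> 'a \<Rightarrow> 'a) \<Rightarrow> bool" where
  "diagram C D F \<longleftrightarrow>
     (\<forall>f\<in>Ar C. continuous_map (D (src C f)) (D (tgt C f)) (F f)) \<and>
     (\<forall>a\<in>Ob C. \<forall>x\<in>topspace (D a). F (ide C a) x = x) \<and>
     (\<forall>f\<in>Ar C. \<forall>g\<in>Ar C. tgt C f = src C g \<longrightarrow>
        (\<forall>x\<in>topspace (D (src C f)). F (cmp C g f) x = F g (F f x)))"

text \<open>An \<open>n\<close>-simplex of the nerve is a functor from the poset \<open>{0, \<dots>, n}\<close>; \<open>s (i, j)\<close> is the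
  value of \<open>s\<close> on the arrow \<open>i \<le> j\<close>, in particular \<open>s (i, i)\<close> is an identity.\<close>

definition nerve :: "('o, 'm) cat \<Rightarrow> nat \<Rightarrow> (nat \<times> nat \<Rightarrow> 'm) set" where
  "nerve C n = {s \<in> extensional {(i, j). i \<le> j \<and> j \<le> n}.
     (\<forall>i\<le>n. \<exists>a\<in>Ob C. s (i, i) = ide C a) \<and>
     (\<forall>i j. i \<le> j \<and> j \<le> n \<longrightarrow>
        s (i, j) \<in> Ar C \<and> src C (s (i, j)) = src C (s (i, i)) \<and> tgt C (s (i, j)) = src C (s (j, j))) \<and>
     (\<forall>i j k. i \<le> j \<and> j \<le> k \<and> k \<le> n \<longrightarrow> s (i, k) = cmp C (s (j, k)) (s (i, j)))}"

definition nerve_act :: "nat \<Rightarrow> (nat \<Rightarrow> nat) \<Rightarrow> (nat \<times> nat \<Rightarrow> 'm) \<Rightarrow> nat \<times> nat \<Rightarrow> 'm" where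
  "nerve_act m \<theta> s = restrict (\<lambda>(i, j). s (\<theta> i, \<theta> j)) {(i, j). i \<le> j \<and> j \<le> m}"

definition classifying_space ::
  "('o, 'm) cat \<Rightarrow> (nat \<times> ((nat \<times> nat \<Rightarrow> 'm) \<times> (nat \<Rightarrow> real))) set topology" where
  "classifying_space C = realization (\<lambda>n. discrete_topology (nerve C n)) nerve_act"

text \<open>The homotopy colimit is the realisation of the simplicial replacement (Bousfield--Kan):
  its space of \<open>n\<close>-simplices is the disjoint union, over chains \<open>i\<^sub>0 \<rightarrow> \<dots> \<rightarrow> i\<^sub>n\<close>, of \<open>D i\<^sub>0\<close>.\<close>

definition simplicial_replacement ::
  "('o, 'm) cat \<Rightarrow> ('o \<Rightarrow> 'a topology) \<Rightarrow> nat \<Rightarrow> ((nat \<times> nat \<Rightarrow> 'm) \<times> 'a) topology" where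
  "simplicial_replacement C D n = sum_topology (\<lambda>s. D (src C (s (0, 0)))) (nerve C n)"

definition simplicial_replacement_act ::
  "('m \<Rightarrow> 'a \<Rightarrow> 'a) \<Rightarrow> nat \<Rightarrow> (nat \<Rightarrow> nat)
     \<Rightarrow> (nat \<times> nat \<Rightarrow> 'm) \<times> 'a \<Rightarrow> (nat \<times> nat \<Rightarrow> 'm) \<times> 'a" where
  "simplicial_replacement_act F m \<theta> = (\<lambda>(s, x). (nerve_act m \<theta> s, F (s (0, \<theta> 0)) x))"

definition hocolim ::
  "('o, 'm) cat \<Rightarrow> ('o \<Rightarrow> 'a topology) \<Rightarrow> ('m \<Rightarrow> 'a \<Rightarrow> 'a)
     \<Rightarrow> (nat \<times> (((nat \<times> nat \<Rightarrow> 'm) \<times> 'a) \<times> (nat \<Rightarrow> real))) set topology" where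
  "hocolim C D F = realization (simplicial_replacement C D) (simplicial_replacement_act F)"

definition hocolim_structure_map ::
  "('o, 'm) cat \<Rightarrow> ('o \<Rightarrow> 'a topology) \<Rightarrow> ('m \<Rightarrow> 'a \<Rightarrow> 'a) \<Rightarrow> 'o \<Rightarrow> 'a
     \<Rightarrow> (nat \<times> (((nat \<times> nat \<Rightarrow> 'm) \<times> 'a) \<times> (nat \<Rightarrow> real))) set" where
  "hocolim_structure_map C D F i x =
     realization_rel (simplicial_replacement C D) (simplicial_replacement_act F) ``
       {(0, ((restrict (\<lambda>_. ide C i) {(0, 0)}, x), (\<lambda>j. if j = 0 then 1 else 0)))}"


section \<open>Classes of continuous maps\<close>

text \<open>A class of maps is a predicate on maps between spaces whose points lie in a fixed type
  \<open>'u\<close>, which plays the role of a universe. A map between spaces over other types belongs to the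
  class iff it is, up to homeomorphisms of source and target, a map between spaces over \<open>'u\<close> that
  does. When \<open>'u\<close> is infinite and \<open>real \<Rightarrow> 'u\<close> injects into \<open>'u\<close>, all the constructions above,
  applied to spaces, objects and arrows in \<open>'u\<close>, are homeomorphic to spaces over \<open>'u\<close>; by
  \<open>class_of_maps.in_class_iff\<close> below the choice of copies does not matter.\<close>

text \<open>Types satisfying the size condition exist above any given type: if \<open>'a\<close> has at least two
  elements, \<open>real \<Rightarrow> 'a\<close> is one.\<close>

lemma universe_exists:
  "(UNIV :: (real \<Rightarrow> real \<Rightarrow> 'a) set) \<lesssim> (UNIV :: (real \<Rightarrow> 'a) set)"
proof -
  have "infinite (UNIV :: real set)"
    by (rule infinite_UNIV_char_0)
  from card_of_Times_same_infinite[OF this]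
  obtain h :: "real \<times> real \<Rightarrow> real" where "bij_betw h (UNIV \<times> UNIV) UNIV"
    using card_of_ordIso by blast
  then have h: "bij h" by simp
  have "inj (\<lambda>(F :: real \<Rightarrow> real \<Rightarrow> 'a) z. case_prod F (inv_into UNIV h z))"
  proof (rule injI)
    fix F G :: "real \<Rightarrow> real \<Rightarrow> 'a"
    assume "(\<lambda>z. case_prod F (inv_into UNIV h z)) = (\<lambda>z. case_prod G (inv_into UNIV h z))"
    then have "case_prod F (inv_into UNIV h (h (a, b))) = case_prod G (inv_into UNIV h (h (a, b)))" for a b
      by meson
    then have "F a b = G a b" for a b
      using h by (simp add: bij_is_inj)
    then show "F = G" by blast
  qed
  then show ?thesis
    unfolding lepoll_def by blast
qed

type_synonym 'u map_class = "'u topology \<Rightarrow> 'u topology \<Rightarrow> ('u \<Rightarrow> 'u) \<Rightarrow> bool"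

definition in_class :: "'u map_class \<Rightarrow> 'a topology \<Rightarrow> 'b topology \<Rightarrow> ('a \<Rightarrow> 'b) \<Rightarrow> bool" where
  "in_class H X Y f \<longleftrightarrow>
     (\<exists>X' Y' \<phi> \<psi> f'. homeomorphic_map X X' \<phi> \<and> homeomorphic_map Y Y' \<psi> \<and> H X' Y' f' \<and>
        (\<forall>x\<in>topspace X. f' (\<phi> x) = \<psi> (f x)))"

definition retract_of_map ::
  "'a topology \<Rightarrow> 'b topology \<Rightarrow> ('a \<Rightarrow> 'b) \<Rightarrow> 'c topology \<Rightarrow> 'd topology \<Rightarrow> ('c \<Rightarrow> 'd) \<Rightarrow> bool" where
  "retract_of_map X Y f X' Y' f' \<longleftrightarrow>
     (\<exists>i r j s. continuous_map X X' i \<and> continuous_map X' X r \<and>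
        continuous_map Y Y' j \<and> continuous_map Y' Y s \<and>
        (\<forall>x\<in>topspace X. r (i x) = x) \<and> (\<forall>y\<in>topspace Y. s (j y) = y) \<and>
        (\<forall>x\<in>topspace X. f' (i x) = j (f x)) \<and> (\<forall>x'\<in>topspace X'. f (r x') = s (f' x')))"

locale class_of_maps =
  fixes H :: "'u map_class"
  assumes continuous: "H X Y f \<Longrightarrow> continuous_map X Y f"
    and weak_equivalences: "weak_homotopy_equivalence X Y f \<Longrightarrow> H X Y f"
    and retracts:
      "\<lbrakk>continuous_map X Y f; H X' Y' f'; retract_of_map X Y f X' Y' f'\<rbrakk> \<Longrightarrow> H X Y f"
    and cancel_left:
      "\<lbrakk>continuous_map X Y f; continuous_map Y Z g; H X Y f\<rbrakk> \<Longrightarrow> H Y Z g \<longleftrightarrow> H X Z (g \<circ> f)"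
    and cancel_weak_equivalence:
      "\<lbrakk>continuous_map X Y f; continuous_map Y Z g; weak_homotopy_equivalence Y Z g\<rbrakk>
         \<Longrightarrow> H X Y f \<longleftrightarrow> H X Z (g \<circ> f)"
    and fibrewise:
      "\<lbrakk>continuous_map E' (B :: 'u topology) p'; continuous_map E B p; continuous_map E' E f;
        \<forall>e\<in>topspace E'. p (f e) = p' e;
        \<forall>b\<in>topspace B. in_class H (hofib E' B p' b) (hofib E B p b) (\<lambda>(e, \<gamma>). (f e, \<gamma>))\<rbrakk>
         \<Longrightarrow> H E' E f"
    and homotopy_colimits:
      "\<lbrakk>category (C :: ('u, 'u) cat); diagram C D F;
        topspace (classifying_space C) \<noteq> {}; contractible_space (classifying_space C);
        \<forall>f\<in>Ar C. H (D (src C f)) (D (tgt C f)) (F f); i \<in> Ob C\<rbrakk>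
         \<Longrightarrow> in_class H (D i) (hocolim C D F) (hocolim_structure_map C D F i)"

definition two_out_of_three :: "'u map_class \<Rightarrow> bool" where
  "two_out_of_three H \<longleftrightarrow>
     (\<forall>X Y Z f g. continuous_map X Y f \<and> continuous_map Y Z g \<longrightarrow>
        (H X Y f \<and> H Y Z g \<longrightarrow> H X Z (g \<circ> f)) \<and>
        (H X Y f \<and> H X Z (g \<circ> f) \<longrightarrow> H Y Z g) \<and>
        (H Y Z g \<and> H X Z (g \<circ> f) \<longrightarrow> H X Y f))"

lemma (in class_of_maps) in_class_iff:
  assumes "continuous_map X Y f" "homeomorphic_map X X' \<phi>" "homeomorphic_map Y Y' \<psi>"
    and "continuous_map X' Y' f'" "\<forall>x\<in>topspace X. f' (\<phi> x) = \<psi> (f x)"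
  shows "in_class H X Y f \<longleftrightarrow> H X' Y' f'"
proof
  assume "H X' Y' f'"
  then show "in_class H X Y f"
    unfolding in_class_def using assms by blast
next
  assume "in_class H X Y f"
  then obtain X1 Y1 \<phi>1 \<psi>1 f1 where
    1: "homeomorphic_map X X1 \<phi>1" "homeomorphic_map Y Y1 \<psi>1" "H X1 Y1 f1"
      "\<forall>x\<in>topspace X. f1 (\<phi>1 x) = \<psi>1 (f x)"
    unfolding in_class_def by blast
  obtain \<phi>' where \<phi>': "homeomorphic_maps X X' \<phi> \<phi>'"
    using assms(2) homeomorphic_map_maps by blast
  obtain \<psi>' where \<psi>': "homeomorphic_maps Y Y' \<psi> \<psi>'"
    using assms(3) homeomorphic_map_maps by blast
  obtain \<phi>1' where \<phi>1': "homeomorphic_maps X X1 \<phi>1 \<phi>1'"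
    using 1 homeomorphic_map_maps by blast
  obtain \<psi>1' where \<psi>1': "homeomorphic_maps Y Y1 \<psi>1 \<psi>1'"
    using 1 homeomorphic_map_maps by blast
  have inX: "\<phi>' x \<in> topspace X" if "x \<in> topspace X'" for x
    using that \<phi>' unfolding homeomorphic_maps_def continuous_map_def by auto
  have inX1: "\<phi>1' x \<in> topspace X" if "x \<in> topspace X1" for x
    using that \<phi>1' unfolding homeomorphic_maps_def continuous_map_def by auto
  have inY: "f x \<in> topspace Y" if "x \<in> topspace X" for x
    using that assms(1) unfolding continuous_map_def by auto
  have inY': "\<psi>' y \<in> topspace Y" if "y \<in> topspace Y'" for y
    using that \<psi>' unfolding homeomorphic_maps_def continuous_map_def by auto
  have "retract_of_map X' Y' f' X1 Y1 f1"
    unfolding retract_of_map_def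
  proof (intro exI conjI ballI)
    show "continuous_map X' X1 (\<phi>1 \<circ> \<phi>')" "continuous_map X1 X' (\<phi> \<circ> \<phi>1')"
      "continuous_map Y' Y1 (\<psi>1 \<circ> \<psi>')" "continuous_map Y1 Y' (\<psi> \<circ> \<psi>1')"
      using \<phi>' \<psi>' \<phi>1' \<psi>1' unfolding homeomorphic_maps_def
      by (auto intro: continuous_map_compose)
  next
    fix x assume x: "x \<in> topspace X'"
    show "(\<phi> \<circ> \<phi>1') ((\<phi>1 \<circ> \<phi>') x) = x"
      using inX[OF x] x \<phi>' \<phi>1' unfolding homeomorphic_maps_def by simp
    have "f' x = \<psi> (f (\<phi>' x))"
      using assms(5) inX[OF x] x \<phi>' unfolding homeomorphic_maps_def by metis
    then show "f1 ((\<phi>1 \<circ> \<phi>') x) = (\<psi>1 \<circ> \<psi>') (f' x)"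
      using inX[OF x] inY[OF inX[OF x]] 1(4) \<psi>' unfolding homeomorphic_maps_def by simp
  next
    fix y assume y: "y \<in> topspace Y'"
    show "(\<psi> \<circ> \<psi>1') ((\<psi>1 \<circ> \<psi>') y) = y"
      using inY'[OF y] y \<psi>' \<psi>1' unfolding homeomorphic_maps_def by simp
  next
    fix x assume x: "x \<in> topspace X1"
    have "f1 x = \<psi>1 (f (\<phi>1' x))"
      using 1(4) inX1[OF x] x \<phi>1' unfolding homeomorphic_maps_def by metis
    then show "f' ((\<phi> \<circ> \<phi>1') x) = (\<psi> \<circ> \<psi>1') (f1 x)"
      using inX1[OF x] inY[OF inX1[OF x]] assms(5) \<psi>1' unfolding homeomorphic_maps_def by simp
  qed
  then show "H X' Y' f'"
    using retracts 1(3) assms(4) by blast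
qed


section \<open>Fibrations and path-lifting maps relative to a class\<close>

definition H_fibration :: "'u map_class \<Rightarrow> 'e topology \<Rightarrow> 'b topology \<Rightarrow> ('e \<Rightarrow> 'b) \<Rightarrow> bool" where
  "H_fibration H E B p \<longleftrightarrow>
     continuous_map E B p \<and>
     (\<forall>b\<in>topspace B. in_class H (fib E p b) (hofib E B p b) (fib_to_hofib b))"

definition universal_H_fibration ::
  "'u map_class \<Rightarrow> 'e topology \<Rightarrow> 'b topology \<Rightarrow> ('e \<Rightarrow> 'b) \<Rightarrow> bool" where
  "universal_H_fibration H E B p \<longleftrightarrow>
     continuous_map E B p \<and>
     (\<forall>n \<sigma>. continuous_map (disc n) B \<sigma> \<longrightarrow>
        H_fibration H (pullback (disc n) E \<sigma> p) (disc n) fst)"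

definition path_lifting_domain ::
  "'e topology \<Rightarrow> 'b topology \<Rightarrow> ('e \<Rightarrow> 'b) \<Rightarrow> ('e \<times> (real \<Rightarrow> 'b)) topology" where
  "path_lifting_domain E B p = subtopology (prod_topology E (path_space B)) {(e, \<gamma>). p e = \<gamma> 0}"

definition path_lifting_map ::
  "'e topology \<Rightarrow> 'b topology \<Rightarrow> ('e \<Rightarrow> 'b) \<Rightarrow> ('e \<times> (real \<Rightarrow> 'b) \<Rightarrow> 'e) \<Rightarrow> bool" where
  "path_lifting_map E B p l \<longleftrightarrow>
     continuous_map (path_lifting_domain E B p) E l \<and>
     (\<forall>(e, \<gamma>)\<in>topspace (path_lifting_domain E B p). p (l (e, \<gamma>)) = \<gamma> 1)"

definition unit_map :: "('e \<Rightarrow> 'b) \<Rightarrow> ('e \<times> (real \<Rightarrow> 'b) \<Rightarrow> 'e) \<Rightarrow> 'e \<Rightarrow> 'e" where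
  "unit_map p l e = l (e, const_path (p e))"

definition induced_path_lifting ::
  "('c \<Rightarrow> 'b) \<Rightarrow> ('e \<times> (real \<Rightarrow> 'b) \<Rightarrow> 'e) \<Rightarrow> ('c \<times> 'e) \<times> (real \<Rightarrow> 'c) \<Rightarrow> 'c \<times> 'e" where
  "induced_path_lifting g l = (\<lambda>((b', e), \<gamma>). (\<gamma> 1, l (e, compose {0..1} g \<gamma>)))"

definition H_path_lifting_map ::
  "'u map_class \<Rightarrow> 'e topology \<Rightarrow> 'b topology \<Rightarrow> ('e \<Rightarrow> 'b) \<Rightarrow> ('e \<times> (real \<Rightarrow> 'b) \<Rightarrow> 'e) \<Rightarrow> bool" where
  "H_path_lifting_map H E B p l \<longleftrightarrow> path_lifting_map E B p l \<and> in_class H E E (unit_map p l)"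

definition universal_H_path_lifting_map ::
  "'u map_class \<Rightarrow> 'e topology \<Rightarrow> 'b topology \<Rightarrow> ('e \<Rightarrow> 'b) \<Rightarrow> ('e \<times> (real \<Rightarrow> 'b) \<Rightarrow> 'e) \<Rightarrow> bool" where
  "universal_H_path_lifting_map H E B p l \<longleftrightarrow>
     path_lifting_map E B p l \<and>
     (\<forall>n \<sigma>. continuous_map (disc n) B \<sigma> \<longrightarrow>
        H_path_lifting_map H (pullback (disc n) E \<sigma> p) (disc n) fst (induced_path_lifting \<sigma> l))"

definition strong_H_fibration ::
  "'u map_class \<Rightarrow> 'e topology \<Rightarrow> 'b topology \<Rightarrow> ('e \<Rightarrow> 'b) \<Rightarrow> bool" where
  "strong_H_fibration H E B p \<longleftrightarrow>
     continuous_map E B p \<and> (\<exists>l. universal_H_path_lifting_map H E B p l)"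

end

(* Over a disc, which is convex, the inclusion i of the fibre into the total space P of the pulled
   back map has, up to the class H, an inverse: let r lift the segment from q(e) to the base point b
   starting at e. Then r i is the unit map of the path-lifting map on the fibre, and i r is homotopic to
   the unit map of P. Since the projection from the homotopy fibre to P is a deformation retraction,
   everything reduces to the following instance of two-out-of-six: if r i and i r lie in H, then so
   does i. This does not follow formally from (2+). By axiom (4), applied to the poset of natural
   numbers, the maps from X and Y to the telescopes of r i and of i r lie in H. These telescopes are
   homotopy equivalent via i, because r i induces on the telescope of r i a homotopy inverse of the
   shift. Homotopy equivalences lie in H by closure under retracts and the factorisation through the
   path-space cocylinder, so no comparison of homotopy groups is needed beyond the projection of a
   cylinder. *)

theory Submission
  imports Defs
begin

section \<open>Path spaces and cylinders\<close>

text \<open>The obstacle is that the telescopes are realisations of the whole nerve of the poset of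
  natural numbers, so every map out of them must respect all simplicial operators. Points are
  therefore described by measures: barycentric coordinates on a chain are pushed forward to a
  probability measure on the levels. The operators preserve this measure, and any finite set of
  levels lies in one chain \<open>0..M\<close>. Homotopies of telescopes become straight lines
  between measures; the same device contracts the classifying space of the poset, as axiom (4)
  demands. The unit map on a fibre lies in H because universality also covers \<open>D^0\<close>,
  where the pullback along a constant map is a fibre. Pairs, paths and telescopes leave the type
  \<open>'u\<close>, so the arguments use \<open>member\<close>, which works through copies in
  \<open>'u\<close>. The cylinder can be treated by hand because its interval coordinate can be
  interpolated affinely without moving base points; a general homotopy equivalence would need
  changes of base point.\<close>

abbreviation unit_interval :: "real topology"
  where "unit_interval \<equiv> top_of_set {0..1}"

lemma topspace_path_space: "topspace (path_space B) = paths B"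
  unfolding path_space_def topology_generated_by_topspace
proof (intro equalityI subsetI)
  fix \<gamma> assume "\<gamma> \<in> paths B"
  moreover have "{\<gamma> \<in> paths B. \<gamma> ` {} \<subseteq> {}}
      \<in> {{\<gamma> \<in> paths B. \<gamma> ` K \<subseteq> U} |K U. compact K \<and> K \<subseteq> {0..1} \<and> openin B U}"
    by (intro CollectI exI[of _ "{}"]) auto
  ultimately show "\<gamma> \<in> \<Union> {{\<gamma> \<in> paths B. \<gamma> ` K \<subseteq> U} |K U. compact K \<and> K \<subseteq> {0..1} \<and> openin B U}"
    by blast
qed auto

lemma openin_path_space_subbasis:
  assumes "compact K" "K \<subseteq> {0..1}" "openin B U"
  shows "openin (path_space B) {\<gamma> \<in> paths B. \<gamma> ` K \<subseteq> U}"
  unfolding path_space_def by (rule topology_generated_by_Basis) (use assms in blast)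

text \<open>For a subbasic set given by a compact \<open>C\<close> and an open \<open>U\<close>, the
  tube lemma applies to \<open>C \<times> {z}\<close>, so \<open>Z\<close> may be arbitrary. This is
  the source of continuity for the path-valued maps below.\<close>

lemma continuous_map_path_space_curry:
  assumes K: "continuous_map (prod_topology unit_interval Z) B K"
  shows "continuous_map Z (path_space B) (\<lambda>z. \<lambda>s\<in>{0..1}. K (s, z))"
proof -
  have inpaths: "(\<lambda>s\<in>{0..1}. K (s, z)) \<in> paths B" if z: "z \<in> topspace Z" for z
  proof -
    have "continuous_map unit_interval B (K \<circ> (\<lambda>s. (s, z)))"
      by (intro continuous_map_compose[OF _ K] continuous_map_pairedI) (auto simp: z)
    then have "continuous_map unit_interval B (\<lambda>s\<in>{0..1}. K (s, z))"
      by (rule continuous_map_eq) auto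
    then show ?thesis by (auto simp: paths_def pathin_def)
  qed
  show ?thesis
    unfolding path_space_def
  proof (rule continuous_on_generated_topo)
    show "(\<lambda>z. \<lambda>s\<in>{0..1}. K (s, z)) ` topspace Z
        \<subseteq> \<Union> {{\<gamma> \<in> paths B. \<gamma> ` K \<subseteq> U} |K U. compact K \<and> K \<subseteq> {0..1} \<and> openin B U}"
      using inpaths topspace_path_space[of B]
      unfolding path_space_def topology_generated_by_topspace by blast
  next
    fix S assume "S \<in> {{\<gamma> \<in> paths B. \<gamma> ` K \<subseteq> U} |K U. compact K \<and> K \<subseteq> {0..1} \<and> openin B U}"
    then obtain C U where S: "S = {\<gamma> \<in> paths B. \<gamma> ` C \<subseteq> U}" and C: "compact C" "C \<subseteq> {0..1}"
      and U: "openin B U" by blast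
    let ?P = "(\<lambda>z. \<lambda>s\<in>{0..1}. K (s, z)) -` S \<inter> topspace Z"
    have P: "?P = {z \<in> topspace Z. \<forall>s\<in>C. K (s, z) \<in> U}"
      using inpaths C by (auto simp: S subset_iff)
    let ?W = "{y \<in> topspace (prod_topology unit_interval Z). K y \<in> U}"
    have W: "openin (prod_topology unit_interval Z) ?W"
      using K U by (rule openin_continuous_map_preimage)
    show "openin Z ?P"
    proof (subst openin_subopen, intro ballI)
      fix z assume z: "z \<in> ?P"
      have "compactin unit_interval C"
        using C by (simp add: compactin_subtopology compactin_euclidean_iff)
      moreover have "C \<times> {z} \<subseteq> ?W" using z C unfolding P by auto
      ultimately obtain V1 V2 where V: "openin Z V2" "C \<subseteq> V1" "z \<in> V2" "V1 \<times> V2 \<subseteq> ?W"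
        using tube_lemma_left[OF W, of C z] z unfolding P by auto
      then have "V2 \<subseteq> ?P" unfolding P using openin_subset by fastforce
      then show "\<exists>T. openin Z T \<and> z \<in> T \<and> T \<subseteq> ?P" using V by blast
    qed
  qed
qed

text \<open>Rests on local compactness of the interval: a closed neighbourhood of \<open>s\<close>
  that \<open>\<gamma>\<close> maps into \<open>V\<close> is compact and hence yields a subbasic set
  of paths.\<close>

lemma continuous_map_path_space_eval:
  "continuous_map (prod_topology unit_interval (path_space B)) B (\<lambda>(s, \<gamma>). \<gamma> s)"
  unfolding continuous_map_def
proof (intro conjI allI impI)
  show "(\<lambda>(s, \<gamma>). \<gamma> s) \<in> topspace (prod_topology unit_interval (path_space B)) \<rightarrow> topspace B"
    by (auto simp: topspace_path_space paths_def pathin_def continuous_map_def)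
next
  fix V assume V: "openin B V"
  let ?S = "{y \<in> topspace (prod_topology unit_interval (path_space B)). (\<lambda>(s, \<gamma>). \<gamma> s) y \<in> V}"
  show "openin (prod_topology unit_interval (path_space B)) ?S"
  proof (subst openin_subopen, intro ballI)
    fix y assume y: "y \<in> ?S"
    obtain s \<gamma> where [simp]: "y = (s, \<gamma>)" by (cases y)
    have s: "s \<in> {0..1}" "\<gamma> \<in> paths B" "\<gamma> s \<in> V" using y by (auto simp: topspace_path_space)
    then have "openin unit_interval {r \<in> topspace unit_interval. \<gamma> r \<in> V}"
      using V by (intro openin_continuous_map_preimage[where Y=B]) (auto simp: paths_def pathin_def)
    then obtain d where d: "d > 0" "\<And>r. r \<in> {0..1} \<Longrightarrow> dist r s < d \<Longrightarrow> \<gamma> r \<in> V"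
      using s unfolding openin_euclidean_subtopology_iff by auto
    \<comment> \<open>Halving makes the closed ball of radius \<open>e\<close> fit; its intersection
      with the interval is the compact set needed.\<close>
    define e where "e = d / 2"
    have e: "e > 0" "\<And>r. r \<in> {0..1} \<Longrightarrow> dist r s \<le> e \<Longrightarrow> \<gamma> r \<in> V"
      using d by (auto simp: e_def)
    let ?K = "cball s e \<inter> {0..1}"
    have K: "compact ?K" by (simp add: compact_Int)
    have "openin unit_interval (ball s e \<inter> {0..1})"
      by (metis inf_commute open_ball openin_open_Int)
    then have "openin (prod_topology unit_interval (path_space B))
        ((ball s e \<inter> {0..1}) \<times> {\<gamma> \<in> paths B. \<gamma> ` ?K \<subseteq> V})"
      using openin_path_space_subbasis[OF K _ V] by (simp add: openin_prod_Times_iff)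
    moreover have "y \<in> (ball s e \<inter> {0..1}) \<times> {\<gamma> \<in> paths B. \<gamma> ` ?K \<subseteq> V}"
      using s e by (auto simp: dist_commute)
    moreover have "(ball s e \<inter> {0..1}) \<times> {\<gamma> \<in> paths B. \<gamma> ` ?K \<subseteq> V} \<subseteq> ?S"
      by (auto simp: topspace_path_space image_subset_iff)
    ultimately show "\<exists>T. openin (prod_topology unit_interval (path_space B)) T \<and> y \<in> T \<and> T \<subseteq> ?S"
      by blast
  qed
qed

lemma continuous_map_path_space_eval_compose:
  assumes "continuous_map Z unit_interval s" "continuous_map Z (path_space B) \<gamma>"
  shows "continuous_map Z B (\<lambda>z. \<gamma> z (s z))"
proof -
  have "continuous_map Z B ((\<lambda>(s, \<gamma>). \<gamma> s) \<circ> (\<lambda>z. (s z, \<gamma> z)))"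
    by (intro continuous_map_compose[OF _ continuous_map_path_space_eval] continuous_map_pairedI assms)
  then show ?thesis by (simp add: o_def)
qed

section \<open>Path components and homotopy groups of a cylinder\<close>

lemma path_component_of_set_eq_iff:
  assumes "x \<in> topspace X" "y \<in> topspace X"
  shows "path_component_of_set X x = path_component_of_set X y \<longleftrightarrow> path_component_of X x y"
  using assms path_component_of_equiv[of X x y] by (auto simp: set_eq_iff fun_eq_iff)

lemma UN_eq_value:
  assumes "\<And>y. y \<in> S \<Longrightarrow> F y = F x" "x \<in> S"
  shows "(\<Union>y\<in>S. F y) = F x"
  using assms by blast

text \<open>The common shape of the arguments for \<open>\<pi>_0\<close> and \<open>\<pi>_n\<close>:
  \<open>cA\<close> and \<open>cB\<close> send a representative to its class, and \<open>F\<close>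
  is the map that \<open>f\<close> induces on classes.\<close>

lemma bij_betw_quotient_classes:
  assumes r: "\<And>a b. a \<in> A \<Longrightarrow> b \<in> A \<Longrightarrow> cA a = cA b \<longleftrightarrow> cB (f a) = cB (f b)"
    and f: "f \<in> A \<rightarrow> B"
    and surj: "\<And>b. b \<in> B \<Longrightarrow> \<exists>a\<in>A. cB (f a) = cB b"
    and F: "\<And>a. a \<in> A \<Longrightarrow> F (cA a) = cB (f a)"
    shows "bij_betw F (cA ` A) (cB ` B)"
  unfolding bij_betw_def
proof
  show "inj_on F (cA ` A)" using r F by (auto simp: inj_on_def)
  show "F ` cA ` A = cB ` B"
    using f F surj by (force simp: image_iff)
qed

lemma spheroid_class_eq_iff:
  assumes "g \<in> spheroids n X x" "h \<in> spheroids n X x"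
  shows "spheroid_class n X x g = spheroid_class n X x h \<longleftrightarrow>
    homotopic_with (\<lambda>k. k ` cube_boundary n \<subseteq> {x}) (cube n) X g h"
proof
  assume "spheroid_class n X x g = spheroid_class n X x h"
  moreover have "h \<in> spheroid_class n X x h"
    using assms unfolding spheroid_class_def spheroids_def by auto
  ultimately show "homotopic_with (\<lambda>k. k ` cube_boundary n \<subseteq> {x}) (cube n) X g h"
    unfolding spheroid_class_def by auto
next
  assume "homotopic_with (\<lambda>k. k ` cube_boundary n \<subseteq> {x}) (cube n) X g h"
  then show "spheroid_class n X x g = spheroid_class n X x h"
    unfolding spheroid_class_def
    by (auto dest: homotopic_with_symD elim: homotopic_with_trans)
qed

lemma affine_in_unit_interval:
  fixes a b t :: real
  assumes "a \<in> {0..1}" "b \<in> {0..1}" "t \<in> {0..1}"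
  shows "(1 - t) * a + t * b \<in> {0..1}"
  using assms convex_bound_le[of a 1 b "1 - t" t] by auto

text \<open>Everything in \<open>X\<close> lifts once an interval coordinate is supplied, and the
  interval is convex: between prescribed ends that coordinate is interpolated affinely, so it stays
  put where the ends agree, and base points are kept. \<open>P\<close> is a copy of the cylinder
  because axiom (0) speaks only of spaces over \<open>'u\<close>, while points of the cylinder are
  pairs.\<close>

lemma weak_homotopy_equivalence_cylinder:
  assumes k: "homeomorphic_maps P (prod_topology unit_interval X) \<phi> k"
  shows "weak_homotopy_equivalence P X (snd \<circ> \<phi>)"
proof -
  let ?f = "snd \<circ> \<phi>" and ?s = "fst \<circ> \<phi>"
  have cont\<phi>: "continuous_map P (prod_topology unit_interval X) \<phi>"
    and contk: "continuous_map (prod_topology unit_interval X) P k"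
    and k\<phi>: "\<And>p. p \<in> topspace P \<Longrightarrow> k (\<phi> p) = p"
    and \<phi>k: "\<And>t x. t \<in> {0..1} \<Longrightarrow> x \<in> topspace X \<Longrightarrow> \<phi> (k (t, x)) = (t, x)"
    using k by (auto simp: homeomorphic_maps_def)
  have contf: "continuous_map P X ?f"
    using cont\<phi> continuous_map_compose continuous_map_snd by blast
  have conts: "continuous_map P unit_interval ?s"
    using cont\<phi> continuous_map_compose continuous_map_fst by blast
  have fP: "?f p \<in> topspace X" if "p \<in> topspace P" for p
    using contf that by (auto simp: continuous_map_def)
  have sP: "?s p \<in> {0..1}" if "p \<in> topspace P" for p
    using conts that by (auto simp: continuous_map_def Pi_iff)
  have kP: "k (t, x) \<in> topspace P" if "t \<in> {0..1}" "x \<in> topspace X" for t x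
    using contk that by (auto simp: continuous_map_def Pi_iff)
  have lift: "continuous_map Z P (\<lambda>z. k (a z, b z))"
    if "continuous_map Z unit_interval a" "continuous_map Z X b" for Z :: "'c topology" and a b
    using continuous_map_compose[OF continuous_map_pairedI[OF that] contk] by (simp add: o_def)
  have aff: "continuous_map Z unit_interval (\<lambda>z. (1 - t z) * a z + t z * b z)"
    if "continuous_map Z unit_interval a" "continuous_map Z unit_interval b"
      "continuous_map Z unit_interval t" for Z :: "'c topology" and a b t
    using that affine_in_unit_interval
    unfolding continuous_map_in_subtopology image_subset_iff_funcset[symmetric] image_subset_iff
    by (auto intro!: continuous_intros)

  have "bij_betw (\<lambda>C. \<Union>x\<in>C. path_component_of_set X (?f x)) (path_components_of P) (path_components_of X)"
    unfolding path_components_of_def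
  proof (rule bij_betw_quotient_classes[where f = ?f])
    show f: "?f \<in> topspace P \<rightarrow> topspace X" using fP by auto
    show "\<exists>p\<in>topspace P. path_component_of_set X (?f p) = path_component_of_set X x"
      if "x \<in> topspace X" for x
      using kP[of 0 x] \<phi>k[of 0 x] that by force
    have fwd: "path_component_of X (?f p) (?f q)" if pq: "path_component_of P p q" for p q
    proof -
      obtain g where "pathin P g" "g 0 = p" "g 1 = q" using pq unfolding path_component_of_def by blast
      then show ?thesis unfolding path_component_of_def
        by (intro exI[of _ "?f \<circ> g"]) (use contf in \<open>auto intro: pathin_compose\<close>)
    qed
    have bwd: "path_component_of P p q"
      if pq: "p \<in> topspace P" "q \<in> topspace P" "path_component_of X (?f p) (?f q)" for p q
    proof -
      obtain g where g: "pathin X g" "g 0 = ?f p" "g 1 = ?f q"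
        using pq unfolding path_component_of_def by blast
      have "pathin P (\<lambda>t. k ((1 - t) * ?s p + t * ?s q, g t))"
        using g sP pq unfolding pathin_def by (intro lift aff) auto
      moreover have "k ((1 - 0) * ?s p + 0 * ?s q, g 0) = p" "k ((1 - 1) * ?s p + 1 * ?s q, g 1) = q"
        using g k\<phi> pq by simp_all
      ultimately show ?thesis unfolding path_component_of_def by blast
    qed
    show "path_component_of_set P p = path_component_of_set P q \<longleftrightarrow>
        path_component_of_set X (?f p) = path_component_of_set X (?f q)"
      if "p \<in> topspace P" "q \<in> topspace P" for p q
      using fwd[of p q] bwd[of p q] that
      by (simp only: path_component_of_set_eq_iff fP) blast
    show "(\<Union>x\<in>path_component_of_set P p. path_component_of_set X (?f x)) = path_component_of_set X (?f p)"
      if p: "p \<in> topspace P" for p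
    proof -
      have "path_component_of_set X (?f q) = path_component_of_set X (?f p)"
        if "path_component_of P p q" for q
        using fwd[OF that] path_component_of_equiv[of X "?f p" "?f q"] by simp
      moreover have "path_component_of P p p" using p by (simp add: path_component_of_refl)
      ultimately show ?thesis 
        by (intro UN_eq_value[where F = "\<lambda>x. path_component_of_set X (?f x)" and x = p]) blast+
    qed
  qed
  moreover have "bij_betw (induced_on_homotopy_group n X ?f p) (homotopy_group n P p) (homotopy_group n X (?f p))"
    if p: "p \<in> topspace P" for n p
    unfolding homotopy_group_def
  proof (rule bij_betw_quotient_classes[where f = "\<lambda>g. ?f \<circ> g"])
    let ?bP = "\<lambda>h. h ` cube_boundary n \<subseteq> {p}" and ?bX = "\<lambda>h. h ` cube_boundary n \<subseteq> {?f p}"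
    have bd: "cube_boundary n \<subseteq> topspace (cube n)" by (auto simp: cube_boundary_def)
    have sph: "?f \<circ> g \<in> spheroids n X (?f p)" if "g \<in> spheroids n P p" for g
      using continuous_map_compose[OF _ contf, of "cube n" g] that
      by (auto simp: spheroids_def image_subset_iff)
    then show "(\<circ>) ?f \<in> spheroids n P p \<rightarrow> spheroids n X (?f p)" by auto
    show "\<exists>g\<in>spheroids n P p. spheroid_class n X (?f p) (?f \<circ> g) = spheroid_class n X (?f p) h"
      if h: "h \<in> spheroids n X (?f p)" for h
    proof -
      have hc: "continuous_map (cube n) X h" and hb: "h ` cube_boundary n \<subseteq> {?f p}"
        using h by (auto simp: spheroids_def)
      \<comment> \<open>The interval coordinate is frozen at that of \<open>p\<close>, so the
        boundary goes to \<open>p\<close> itself.\<close>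
      let ?g = "\<lambda>z. k (?s p, h z)"
      have "continuous_map (cube n) P ?g"
        using hc sP[OF p] by (intro lift) auto
      moreover have "?g ` cube_boundary n \<subseteq> {p}" using hb k\<phi>[OF p] by force
      ultimately have g: "?g \<in> spheroids n P p" by (simp add: spheroids_def)
      have fg: "(?f \<circ> ?g) z = h z" if "z \<in> topspace (cube n)" for z
        using \<phi>k[OF sP[OF p], of "h z"] hc that by (auto simp: continuous_map_def Pi_iff)
      have "homotopic_with ?bX (cube n) X (?f \<circ> ?g) h"
        using sph[OF g] hb fg
        by (intro homotopic_with_equal) (simp_all add: spheroids_def del: o_apply)
      then have "spheroid_class n X (?f p) (?f \<circ> ?g) = spheroid_class n X (?f p) h"
        using spheroid_class_eq_iff[OF sph[OF g] h] by simp
      with g show ?thesis by blast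
    qed
    have fwd: "homotopic_with ?bX (cube n) X (?f \<circ> g) (?f \<circ> h)" if "homotopic_with ?bP (cube n) P g h" for g h
      using that contf by (rule homotopic_with_compose_continuous_map_left) (auto simp: image_subset_iff)
    have bwd: "homotopic_with ?bP (cube n) P g h"
      if g: "g \<in> spheroids n P p" and h: "h \<in> spheroids n P p"
        and gh: "homotopic_with ?bX (cube n) X (?f \<circ> g) (?f \<circ> h)" for g h
    proof -
      obtain G where G: "continuous_map (prod_topology unit_interval (cube n)) X G"
        "\<And>z. G (0, z) = (?f \<circ> g) z" "\<And>z. G (1, z) = (?f \<circ> h) z"
        "\<And>t. t \<in> {0..1} \<Longrightarrow> ?bX (\<lambda>z. G (t, z))"
        using gh unfolding homotopic_with_def by auto
      have gc: "continuous_map (cube n) P g" "g ` cube_boundary n \<subseteq> {p}"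
        and hc: "continuous_map (cube n) P h" "h ` cube_boundary n \<subseteq> {p}"
        using g h by (auto simp: spheroids_def)
      \<comment> \<open>On the boundary \<open>g\<close> and \<open>h\<close> both equal
        \<open>p\<close>, so the affine combination is the constant \<open>?s p\<close>.\<close>
      let ?K = "\<lambda>y. k ((1 - fst y) * ?s (g (snd y)) + fst y * ?s (h (snd y)), G y)"
      have cont: "continuous_map (prod_topology unit_interval (cube n)) P ?K"
      proof (intro lift aff G)
        show "continuous_map (prod_topology unit_interval (cube n)) unit_interval (\<lambda>y. ?s (g (snd y)))"
          "continuous_map (prod_topology unit_interval (cube n)) unit_interval (\<lambda>y. ?s (h (snd y)))"
          using continuous_map_compose[OF continuous_map_compose[OF continuous_map_snd gc(1)] conts]
            continuous_map_compose[OF continuous_map_compose[OF continuous_map_snd hc(1)] conts]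
          by (simp_all add: o_def)
        show "continuous_map (prod_topology unit_interval (cube n)) unit_interval fst"
          by (rule continuous_map_fst)
      qed
      show ?thesis
      proof (rule iffD2[OF homotopic_with], goal_cases)
        case (1 a b)
        then have "a ` cube_boundary n = b ` cube_boundary n"
            using bd by (intro image_cong) auto
        then show ?case by simp
      next
        case 2
        show ?case
        proof (intro exI conjI ballI)
          show "continuous_map (prod_topology unit_interval (cube n)) P ?K" by (rule cont)
          fix z assume z: "z \<in> topspace (cube n)"
          then have "g z \<in> topspace P" "h z \<in> topspace P" using gc hc by (auto simp: continuous_map_def)
          then show "?K (0, z) = g z" "?K (1, z) = h z" using G k\<phi> by (auto simp del: o_apply simp: o_def)
        next
          fix t :: real assume t: "t \<in> {0..1}"
          have "?K (t, z) = p" if z: "z \<in> cube_boundary n" for z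
          proof -
            have "g z = p" "h z = p" "G (t, z) = ?f p" using gc hc G(4)[OF t] z by auto
            then have "?K (t, z) = k (?s p, ?f p)" by (simp add: algebra_simps)
            then show ?thesis using k\<phi>[OF p] by simp
          qed
          then show "(\<lambda>z. ?K (t, z)) ` cube_boundary n \<subseteq> {p}" by auto
        qed
      qed
    qed
    show eq: "spheroid_class n P p g = spheroid_class n P p h \<longleftrightarrow>
        spheroid_class n X (?f p) (?f \<circ> g) = spheroid_class n X (?f p) (?f \<circ> h)"
      if "g \<in> spheroids n P p" "h \<in> spheroids n P p" for g h
      using that sph fwd bwd by (metis spheroid_class_eq_iff)
    show "induced_on_homotopy_group n X ?f p (spheroid_class n P p g) = spheroid_class n X (?f p) (?f \<circ> g)"
      if g: "g \<in> spheroids n P p" for g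
    proof -
      have "spheroid_class n X (?f p) (?f \<circ> h) = spheroid_class n X (?f p) (?f \<circ> g)"
        if "h \<in> spheroid_class n P p g" for h
        using that g eq[of g h] spheroid_class_eq_iff[of g n P p h] by (auto simp: spheroid_class_def)
      moreover have "g \<in> spheroid_class n P p g"
        using g unfolding spheroid_class_def spheroids_def by auto
      ultimately show ?thesis unfolding induced_on_homotopy_group_def
        by (intro UN_eq_value[where F = "\<lambda>h. spheroid_class n X (?f p) (?f \<circ> h)" and x = g])
    qed
  qed
  ultimately show ?thesis
    unfolding weak_homotopy_equivalence_def using contf by blast
qed

section \<open>Homotopy invariance of the class\<close>

lemma homeomorphic_copy_exists:
  assumes "topspace X \<lesssim> (UNIV :: 'u set)"
  obtains X' :: "'u topology" and \<phi> \<phi>' where "homeomorphic_maps X X' \<phi> \<phi>'"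
proof -
  obtain f :: "'a \<Rightarrow> 'u" where inj: "inj_on f (topspace X)"
    using assms unfolding lepoll_def by blast
  let ?g = "inv_into (topspace X) f"
  \<comment> \<open>The topology is transported along the inverse of the injection, so the copy
    lives on the image of \<open>X\<close>.\<close>
  let ?X' = "pullback_topology (f ` topspace X) ?g X"
  have gf: "?g (f x) = x" if "x \<in> topspace X" for x
    using inj that by simp
  have top: "topspace ?X' = f ` topspace X"
    using gf by (auto simp: topspace_pullback_topology)
  have "continuous_map X ?X' f"
    unfolding continuous_map_def
  proof (intro conjI allI impI)
    show "f \<in> topspace X \<rightarrow> topspace ?X'" using top by auto
    fix U assume "openin ?X' U"
    then obtain V where V: "openin X V" "U = ?g -` V \<inter> f ` topspace X"
      unfolding openin_pullback_topology by blast
    then have "{x \<in> topspace X. f x \<in> U} = V"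
      using gf openin_subset[OF V(1)] by (auto simp: V(2)) (metis gf subsetD)
    then show "openin X {x \<in> topspace X. f x \<in> U}" using V by simp
  qed
  moreover have "continuous_map ?X' X ?g"
    unfolding continuous_map_def
  proof (intro conjI allI impI)
    show "?g \<in> topspace ?X' \<rightarrow> topspace X" using top gf by auto
    fix U assume "openin X U"
    then show "openin ?X' {x \<in> topspace ?X'. ?g x \<in> U}"
      unfolding openin_pullback_topology top by (intro exI[of _ U]) auto
  qed
  ultimately have "homeomorphic_maps X ?X' f ?g"
    unfolding homeomorphic_maps_def using top gf by auto
  then show thesis by (rule that)
qed

lemma real_lepoll_universe:
  assumes "infinite (UNIV :: 'u set)" "(UNIV :: (real \<Rightarrow> 'u) set) \<lesssim> (UNIV :: 'u set)"
  shows "(UNIV :: real set) \<lesssim> (UNIV :: 'u set)"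
proof -
  obtain a b :: 'u where "a \<noteq> b"
    using assms(1) by (metis (full_types) finite.simps UNIV_eq_I insertI1 singletonI)
  then have "inj (\<lambda>(x::real) y. if y = x then a else b)"
    by (intro injI) (metis (mono_tags))
  then have "(UNIV :: real set) \<lesssim> (UNIV :: (real \<Rightarrow> 'u) set)"
    unfolding lepoll_def by blast
  then show ?thesis using assms(2) lepoll_trans by blast
qed

lemma lepoll_Times_universe:
  assumes "infinite (UNIV :: 'u set)" "A \<lesssim> (UNIV :: 'u set)" "B \<lesssim> (UNIV :: 'u set)"
  shows "A \<times> B \<lesssim> (UNIV :: 'u set)"
proof -
  obtain h :: "'u \<times> 'u \<Rightarrow> 'u" where "bij_betw h (UNIV \<times> UNIV) UNIV"
    using card_of_Times_same_infinite[OF assms(1)] card_of_ordIso by blast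
  then have "inj h" by (simp add: bij_betw_def)
  then have "(UNIV :: 'u set) \<times> (UNIV :: 'u set) \<lesssim> (UNIV :: 'u set)"
    unfolding lepoll_def by auto
  then show ?thesis using times_lepoll_mono[OF assms(2,3)] lepoll_trans by blast
qed

lemma lepoll_fun_universe:
  assumes "(UNIV :: (real \<Rightarrow> 'u) set) \<lesssim> (UNIV :: 'u set)" "(UNIV :: 'a set) \<lesssim> (UNIV :: 'u set)"
  shows "(UNIV :: (real \<Rightarrow> 'a) set) \<lesssim> (UNIV :: 'u set)"
proof -
  obtain h :: "'a \<Rightarrow> 'u" where "inj h" using assms(2) unfolding lepoll_def by auto
  then have "inj (\<lambda>f :: real \<Rightarrow> 'a. h \<circ> f)" by (simp add: fun.inj_map)
  then have "(UNIV :: (real \<Rightarrow> 'a) set) \<lesssim> (UNIV :: (real \<Rightarrow> 'u) set)"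
    unfolding lepoll_def by auto
  then show ?thesis using assms(1) lepoll_trans by blast
qed

lemma lepoll_nat_fun_universe:
  assumes "(UNIV :: (real \<Rightarrow> 'u) set) \<lesssim> (UNIV :: 'u set)" "(UNIV :: 'a set) \<lesssim> (UNIV :: 'u set)"
  shows "(UNIV :: (nat \<Rightarrow> 'a) set) \<lesssim> (UNIV :: 'u set)"
proof -
  \<comment> \<open>Precomposition with \<open>nat \<lfloor>x\<rfloor>\<close>, which maps the reals
    onto the naturals, is injective.\<close>
  have "inj (\<lambda>(f :: nat \<Rightarrow> 'a) (x :: real). f (nat \<lfloor>x\<rfloor>))"
  proof (rule injI)
    fix f g :: "nat \<Rightarrow> 'a" assume "(\<lambda>x::real. f (nat \<lfloor>x\<rfloor>)) = (\<lambda>x. g (nat \<lfloor>x\<rfloor>))"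
    then have "f (nat \<lfloor>real n\<rfloor>) = g (nat \<lfloor>real n\<rfloor>)" for n by meson
    then show "f = g" by auto
  qed
  then have "(UNIV :: (nat \<Rightarrow> 'a) set) \<lesssim> (UNIV :: (real \<Rightarrow> 'a) set)"
    unfolding lepoll_def by auto
  then show ?thesis using lepoll_fun_universe[OF assms] lepoll_trans by blast
qed

text \<open>The size conditions allow cylinders and path spaces of small spaces to be copied into
  \<open>'u\<close>, and they provide codes for pairs of naturals.\<close>

locale saturated_class = class_of_maps H for H :: "'u map_class" +
  assumes two_of_three: "two_out_of_three H"
    and infinite_universe: "infinite (UNIV :: 'u set)"
    and universe_lepoll: "(UNIV :: (real \<Rightarrow> 'u) set) \<lesssim> (UNIV :: 'u set)"
begin

text \<open>Membership in \<^term>\<open>in_class H\<close> alone does not make a map continuous, since the homeomorphism on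
  the target is unconstrained outside the space.\<close>

definition member :: "'a topology \<Rightarrow> 'b topology \<Rightarrow> ('a \<Rightarrow> 'b) \<Rightarrow> bool" where
  "member X Y f \<longleftrightarrow> continuous_map X Y f \<and> in_class H X Y f"

lemma member_iff:
  assumes "continuous_map X Y f" "homeomorphic_maps X X' \<phi> \<phi>'" "homeomorphic_maps Y Y' \<psi> \<psi>'"
  shows "member X Y f \<longleftrightarrow> H X' Y' (\<psi> \<circ> f \<circ> \<phi>')"
proof -
  have "continuous_map X' Y' (\<psi> \<circ> f \<circ> \<phi>')"
    using assms unfolding homeomorphic_maps_def by (meson continuous_map_compose)
  moreover have "homeomorphic_map X X' \<phi>" "homeomorphic_map Y Y' \<psi>"
    using assms homeomorphic_map_maps by blast+
  moreover have "\<forall>x\<in>topspace X. (\<psi> \<circ> f \<circ> \<phi>') (\<phi> x) = \<psi> (f x)"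
    using assms by (simp add: homeomorphic_maps_def)
  ultimately show ?thesis
    using in_class_iff[OF assms(1)] assms(1) unfolding member_def by blast
qed

lemma memberD:
  assumes "member X Y f"
  shows "continuous_map X Y f" "topspace X \<lesssim> (UNIV :: 'u set)" "topspace Y \<lesssim> (UNIV :: 'u set)"
proof -
  show "continuous_map X Y f" using assms by (simp add: member_def)
  obtain X' Y' :: "'u topology" and \<phi> \<psi>
    where *: "homeomorphic_map X X' \<phi>" "homeomorphic_map Y Y' \<psi>"
    using assms unfolding member_def in_class_def by blast
  then show "topspace X \<lesssim> (UNIV :: 'u set)" "topspace Y \<lesssim> (UNIV :: 'u set)"
    unfolding homeomorphic_eq_everything_map lepoll_def by blast+
qed

lemma member_eq_on:
  assumes "member X Y f" "\<And>x. x \<in> topspace X \<Longrightarrow> f x = g x"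
  shows "member X Y g"
proof -
  have "continuous_map X Y g" using memberD(1)[OF assms(1)] assms(2) continuous_map_eq by blast
  moreover have "in_class H X Y g"
    using assms unfolding member_def in_class_def by (metis (no_types, lifting))
  ultimately show ?thesis by (simp add: member_def)
qed

text \<open>One copy per space, used for all the maps, makes the copies composable;
  \<open>in_class_iff\<close> guarantees that membership does not depend on the copies.\<close>

lemma two_of_three_transport:
  assumes f: "continuous_map X Y f" and g: "continuous_map Y Z g"
    and small: "topspace X \<lesssim> (UNIV :: 'u set)" "topspace Y \<lesssim> (UNIV :: 'u set)"
      "topspace Z \<lesssim> (UNIV :: 'u set)"
  shows "(member X Y f \<and> member Y Z g \<longrightarrow> member X Z (g \<circ> f)) \<and>
    (member X Y f \<and> member X Z (g \<circ> f) \<longrightarrow> member Y Z g) \<and>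
    (member Y Z g \<and> member X Z (g \<circ> f) \<longrightarrow> member X Y f)"
proof -
  obtain X' :: "'u topology" and \<phi> \<phi>' where X': "homeomorphic_maps X X' \<phi> \<phi>'"
    using small(1) by (rule homeomorphic_copy_exists)
  obtain Y' :: "'u topology" and \<psi> \<psi>' where Y': "homeomorphic_maps Y Y' \<psi> \<psi>'"
    using small(2) by (rule homeomorphic_copy_exists)
  obtain Z' :: "'u topology" and \<eta> \<eta>' where Z': "homeomorphic_maps Z Z' \<eta> \<eta>'"
    using small(3) by (rule homeomorphic_copy_exists)
  let ?f = "\<psi> \<circ> f \<circ> \<phi>'" and ?g = "\<eta> \<circ> g \<circ> \<psi>'"
  have gf: "continuous_map X Z (g \<circ> f)" using f g by (rule continuous_map_compose)
  have f': "continuous_map X' Y' ?f" and g': "continuous_map Y' Z' ?g"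
    using f g X' Y' Z' unfolding homeomorphic_maps_def by (meson continuous_map_compose)+
  have eq: "(?g \<circ> ?f) (\<phi> x) = \<eta> ((g \<circ> f) x)" if "x \<in> topspace X" for x
  proof -
    have "f x \<in> topspace Y" using f that by (auto simp: continuous_map_def)
    then show ?thesis using X' Y' that by (simp add: homeomorphic_maps_def)
  qed
  have "homeomorphic_map X X' \<phi>" "homeomorphic_map Z Z' \<eta>"
    using X' Z' homeomorphic_map_maps by blast+
  then have "in_class H X Z (g \<circ> f) \<longleftrightarrow> H X' Z' (?g \<circ> ?f)"
    using eq by (intro in_class_iff[OF gf _ _ continuous_map_compose[OF f' g']]) auto
  then have "member X Z (g \<circ> f) \<longleftrightarrow> H X' Z' (?g \<circ> ?f)"
    using gf by (simp add: member_def)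
  moreover have "member X Y f \<longleftrightarrow> H X' Y' ?f" "member Y Z g \<longleftrightarrow> H Y' Z' ?g"
    using member_iff[OF f X' Y'] member_iff[OF g Y' Z'] .
  ultimately show ?thesis
    using two_of_three f' g' unfolding two_out_of_three_def by blast
qed

lemma member_compose:
  assumes "member X Y f" "member Y Z g"
  shows "member X Z (g \<circ> f)"
  using two_of_three_transport[of X Y f Z g] assms memberD[OF assms(1)] memberD[OF assms(2)] by blast

lemma member_cancel_right:
  assumes "member X Y f" "continuous_map Y Z g" "member X Z (g \<circ> f)"
  shows "member Y Z g"
  using two_of_three_transport[of X Y f Z g] assms memberD[OF assms(1)] memberD[OF assms(3)] by blast

lemma member_cancel_left:
  assumes "continuous_map X Y f" "member Y Z g" "member X Z (g \<circ> f)"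
  shows "member X Y f"
  using two_of_three_transport[of X Y f Z g] assms memberD[OF assms(2)] memberD[OF assms(3)] by blast

lemma member_retract:
  assumes f: "continuous_map X Y f" and f': "member X' Y' f'"
    and ir: "continuous_map X X' i" "continuous_map X' X r" "\<And>x. x \<in> topspace X \<Longrightarrow> r (i x) = x"
    and js: "continuous_map Y Y' j" "continuous_map Y' Y s" "\<And>y. y \<in> topspace Y \<Longrightarrow> s (j y) = y"
    and comm: "\<And>x. x \<in> topspace X \<Longrightarrow> f' (i x) = j (f x)" "\<And>x'. x' \<in> topspace X' \<Longrightarrow> f (r x') = s (f' x')"
  shows "member X Y f"
proof -
  \<comment> \<open>The sections \<open>i\<close> and \<open>j\<close> are injective, so
    \<open>X\<close> and \<open>Y\<close> inherit the size bound from \<open>X'\<close> and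
    \<open>Y'\<close>.\<close>
  have "topspace X \<lesssim> topspace X'" "topspace Y \<lesssim> topspace Y'"
    unfolding lepoll_def using ir js
    by (metis (no_types, lifting) continuous_map_image_subset_topspace inj_on_def)+
  then have "topspace X \<lesssim> (UNIV :: 'u set)" "topspace Y \<lesssim> (UNIV :: 'u set)"
    using memberD(2,3)[OF f'] lepoll_trans by blast+
  then obtain X1 :: "'u topology" and \<phi> \<phi>' and Y1 :: "'u topology" and \<psi> \<psi>'
    where X1: "homeomorphic_maps X X1 \<phi> \<phi>'" and Y1: "homeomorphic_maps Y Y1 \<psi> \<psi>'"
    using homeomorphic_copy_exists by metis
  obtain X2 :: "'u topology" and \<alpha> \<alpha>' and Y2 :: "'u topology" and \<beta> \<beta>'
    where X2: "homeomorphic_maps X' X2 \<alpha> \<alpha>'" and Y2: "homeomorphic_maps Y' Y2 \<beta> \<beta>'"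
    using homeomorphic_copy_exists memberD(2,3)[OF f'] by metis
  have cont: "continuous_map X1 Y1 (\<psi> \<circ> f \<circ> \<phi>')"
    using f X1 Y1 unfolding homeomorphic_maps_def by (meson continuous_map_compose)
  have H2: "H X2 Y2 (\<beta> \<circ> f' \<circ> \<alpha>')"
    using f' member_iff[OF memberD(1)[OF f'] X2 Y2] by blast
  have pts: "f x \<in> topspace Y" "i x \<in> topspace X'" if "x \<in> topspace X" for x
    using that f ir by (auto simp: continuous_map_def)
  have pts': "r x \<in> topspace X" "f' x \<in> topspace Y'" if "x \<in> topspace X'" for x
    using that memberD(1)[OF f'] ir by (auto simp: continuous_map_def)
  have ptsj: "j y \<in> topspace Y'" if "y \<in> topspace Y" for y
    using that js by (auto simp: continuous_map_def)
  have \<phi>': "\<phi>' x \<in> topspace X" "\<phi> (\<phi>' x) = x" if "x \<in> topspace X1" for x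
    using that X1 by (auto simp: homeomorphic_maps_def continuous_map_def)
  have \<psi>': "\<psi>' x \<in> topspace Y" "\<psi> (\<psi>' x) = x" if "x \<in> topspace Y1" for x
    using that Y1 by (auto simp: homeomorphic_maps_def continuous_map_def)
  have \<alpha>'': "\<alpha>' x \<in> topspace X'" "\<alpha> (\<alpha>' x) = x" if "x \<in> topspace X2" for x
    using that X2 by (auto simp: homeomorphic_maps_def continuous_map_def)
  have inv: "\<And>x. x \<in> topspace X \<Longrightarrow> \<phi>' (\<phi> x) = x" "\<And>x. x \<in> topspace Y \<Longrightarrow> \<psi>' (\<psi> x) = x"
    "\<And>x. x \<in> topspace X' \<Longrightarrow> \<alpha>' (\<alpha> x) = x" "\<And>x. x \<in> topspace Y' \<Longrightarrow> \<beta>' (\<beta> x) = x"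
    using X1 Y1 X2 Y2 by (auto simp: homeomorphic_maps_def)
  have "retract_of_map X1 Y1 (\<psi> \<circ> f \<circ> \<phi>') X2 Y2 (\<beta> \<circ> f' \<circ> \<alpha>')"
    unfolding retract_of_map_def
  proof (intro exI conjI ballI)
    show "continuous_map X1 X2 (\<alpha> \<circ> i \<circ> \<phi>')" "continuous_map X2 X1 (\<phi> \<circ> r \<circ> \<alpha>')"
      "continuous_map Y1 Y2 (\<beta> \<circ> j \<circ> \<psi>')" "continuous_map Y2 Y1 (\<psi> \<circ> s \<circ> \<beta>')"
      using ir js X1 X2 Y1 Y2 unfolding homeomorphic_maps_def by (meson continuous_map_compose)+
  qed (simp_all add: \<phi>' \<psi>' \<alpha>'' inv pts pts' ptsj ir js comm)
  then have "H X1 Y1 (\<psi> \<circ> f \<circ> \<phi>')"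
    using retracts cont H2 by blast
  then show ?thesis using member_iff[OF f X1 Y1] by blast
qed

section \<open>Cylinders, homotopies and homotopy equivalences in the class\<close>

lemma member_snd_cylinder:
  assumes "topspace X \<lesssim> (UNIV :: 'u set)"
  shows "member (prod_topology unit_interval X) X snd"
proof -
  have "topspace (prod_topology unit_interval X) \<lesssim> (UNIV :: real set) \<times> topspace X"
    by (intro subset_imp_lepoll) auto
  also have "\<dots> \<lesssim> (UNIV :: 'u set)"
    using lepoll_Times_universe[OF infinite_universe
        real_lepoll_universe[OF infinite_universe universe_lepoll] assms] .
  finally obtain P :: "'u topology" and \<phi> \<phi>'
    where P: "homeomorphic_maps (prod_topology unit_interval X) P \<phi> \<phi>'"
    by (rule homeomorphic_copy_exists)
  obtain X' :: "'u topology" and \<psi> \<psi>' where X': "homeomorphic_maps X X' \<psi> \<psi>'"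
    using assms by (rule homeomorphic_copy_exists)
  have "homeomorphic_maps (prod_topology unit_interval X) (prod_topology unit_interval X')
      (\<lambda>(t, x). (t, \<psi> x)) (\<lambda>(t, x). (t, \<psi>' x))"
    using X' by (simp add: homeomorphic_maps_prod homeomorphic_maps_id[unfolded id_def])
  then have "homeomorphic_maps P (prod_topology unit_interval X')
      ((\<lambda>(t, x). (t, \<psi> x)) \<circ> \<phi>') (\<phi> \<circ> (\<lambda>(t, x). (t, \<psi>' x)))"
    using P homeomorphic_maps_compose homeomorphic_maps_sym by metis
  \<comment> \<open>Axiom (0) enters here, for a copy \<open>P\<close> of the cylinder.\<close>
  then have "H P X' (snd \<circ> ((\<lambda>(t, x). (t, \<psi> x)) \<circ> \<phi>'))"
    by (intro weak_equivalences weak_homotopy_equivalence_cylinder)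
  moreover have "snd \<circ> ((\<lambda>(t, x). (t, \<psi> x)) \<circ> \<phi>') = \<psi> \<circ> snd \<circ> \<phi>'"
    by (auto simp: fun_eq_iff split_def)
  ultimately show ?thesis
    using member_iff[OF continuous_map_snd P X'] by simp
qed

text \<open>The equation \<open>snd \<circ> id = snd\<close> on the cylinder gives the identity of
  the cylinder by two-out-of-three; the identity of \<open>X\<close> is a retract of it through the
  bottom end.\<close>

lemma member_id:
  assumes X: "topspace X \<lesssim> (UNIV :: 'u set)"
  shows "member X X id"
proof -
  let ?P = "prod_topology unit_interval X"
  note snd = member_snd_cylinder[OF X]
  have "member ?P ?P id"
    using member_cancel_left[OF continuous_map_id snd] snd by simp
  then show ?thesis
    by (rule member_retract[where i = "Pair 0" and r = snd and j = "Pair 0" and s = snd, OF continuous_map_id])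
      (auto intro!: continuous_map_pairedI continuous_map_snd)
qed

text \<open>The ends of the cylinder are sections of its projection, hence in the class by
  cancellation. The homotopy \<open>h\<close> inherits membership from its bottom end and passes it
  on to its top end.\<close>

lemma member_homotopic:
  assumes fg: "homotopic_with (\<lambda>_. True) X Y f g" and f: "member X Y f"
  shows "member X Y g"
proof -
  let ?P = "prod_topology unit_interval X"
  obtain h where h: "continuous_map ?P Y h" "\<And>x. h (0, x) = f x" "\<And>x. h (1, x) = g x"
    using fg unfolding homotopic_with_def by blast
  have X: "topspace X \<lesssim> (UNIV :: 'u set)" using memberD[OF f] by blast
  have j: "member X ?P (Pair t)" if "t \<in> {0..1}" for t
  proof (rule member_cancel_left[OF _ member_snd_cylinder[OF X]])
    show "continuous_map X ?P (Pair t)" using that by (auto intro!: continuous_map_pairedI)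
    show "member X X (snd \<circ> Pair t)" using member_id[OF X] by (simp add: o_def id_def)
  qed
  have "member ?P Y h"
    using member_cancel_right[OF j[of 0] h(1)] f h(2) by (simp add: o_def)
  then show ?thesis
    using member_compose[OF j[of 1], of Y h] h(3) by (simp add: o_def)
qed

text \<open>As a map, \<open>i\<close> is a retract of \<open>i \<circ> r\<close>, which is
  homotopic to the identity; \<open>r\<close> then follows by cancellation from
  \<open>r \<circ> i\<close>, which is the identity on \<open>A\<close>.\<close>

lemma member_deformation_retraction:
  assumes i: "continuous_map A X i" and r: "continuous_map X A r"
    and X: "topspace X \<lesssim> (UNIV :: 'u set)"
    and ri: "\<And>a. a \<in> topspace A \<Longrightarrow> r (i a) = a"
    and ir: "homotopic_with (\<lambda>_. True) X X id (i \<circ> r)"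
  shows "member A X i" "member X A r"
proof -
  have "member X X (i \<circ> r)" using member_homotopic[OF ir member_id[OF X]] .
  then show i': "member A X i"
    by (rule member_retract[where i = i and r = r and j = id and s = id, OF i])
      (use i r ri in auto)
  have "topspace A \<lesssim> (UNIV :: 'u set)" using memberD[OF i'] by blast
  then have "member A A (r \<circ> i)"
    using member_eq_on[OF member_id] ri by fastforce
  then show "member X A r" using member_cancel_right[OF i' r] by blast
qed

text \<open>\<open>N\<close> is the path-space cocylinder of \<open>f\<close>. It deforms to
  \<open>X\<close> by shrinking paths to their start, and its endpoint map \<open>q\<close> has a
  section made from the homotopy between \<open>f \<circ> g\<close> and \<open>id\<close>. Thus
  \<open>member_deformation_retraction\<close> covers both factors of
  \<open>f = q \<circ> c\<close>.\<close>

lemma member_homotopy_equivalence: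
  assumes f: "continuous_map X Y f" and g: "continuous_map Y X g"
    and gf: "homotopic_with (\<lambda>_. True) X X (g \<circ> f) id"
    and fg: "homotopic_with (\<lambda>_. True) Y Y (f \<circ> g) id"
    and small: "topspace X \<lesssim> (UNIV :: 'u set)" "topspace Y \<lesssim> (UNIV :: 'u set)"
  shows "member X Y f"
proof -
  define N where "N = subtopology (prod_topology X (path_space Y)) {(x, \<gamma>). \<gamma> 0 = f x}"
  define c where "c = (\<lambda>x. (x, const_path (f x)))"
  define q where "q = (\<lambda>(x::'a, \<gamma>::real \<Rightarrow> 'b). \<gamma> 1)"
  have N: "topspace N \<lesssim> (UNIV :: 'u set)"
  proof -
    obtain e :: "'b \<Rightarrow> 'u" where e: "inj_on e (topspace Y)"
      using small(2) unfolding lepoll_def by blast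
    \<comment> \<open>Clamping keeps the argument in the unit interval, so a path becomes a function
      on all reals with values where \<open>e\<close> is injective.\<close>
    have "inj_on (\<lambda>\<gamma> t. e (\<gamma> (min 1 (max 0 t)))) (paths Y)"
    proof (rule inj_onI)
      fix \<gamma> \<delta> assume *: "\<gamma> \<in> paths Y" "\<delta> \<in> paths Y"
        and eq: "(\<lambda>t::real. e (\<gamma> (min 1 (max 0 t)))) = (\<lambda>t. e (\<delta> (min 1 (max 0 t))))"
      have "\<gamma> t = \<delta> t" if t: "t \<in> {0..1}" for t
      proof -
        have "min 1 (max 0 t) = t" using t by auto
        then have "e (\<gamma> t) = e (\<delta> t)" using fun_cong[OF eq, of t] by simp
        moreover have "\<gamma> t \<in> topspace Y" "\<delta> t \<in> topspace Y"
          using * t by (auto simp: paths_def pathin_def continuous_map_def)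
        ultimately show ?thesis using e by (simp add: inj_on_eq_iff)
      qed
      then show "\<gamma> = \<delta>" using * by (auto simp: paths_def intro: extensionalityI)
    qed
    then have "paths Y \<lesssim> (UNIV :: (real \<Rightarrow> 'u) set)" unfolding lepoll_def by blast
    then have "paths Y \<lesssim> (UNIV :: 'u set)" using universe_lepoll lepoll_trans by blast
    then have "topspace X \<times> paths Y \<lesssim> (UNIV :: 'u set)"
      using lepoll_Times_universe[OF infinite_universe small(1)] by blast
    moreover have "topspace N \<subseteq> topspace X \<times> paths Y"
      by (auto simp: N_def topspace_path_space)
    ultimately show ?thesis using subset_imp_lepoll lepoll_trans by blast
  qed
  obtain k where k: "continuous_map (prod_topology unit_interval Y) Y k"
    "\<And>y. k (0, y) = f (g y)" "\<And>y. k (1, y) = y"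
    using fg unfolding homotopic_with_def by auto
  \<comment> \<open>The path component runs from \<open>f (g y)\<close> to \<open>y\<close>, so
    \<open>q \<circ> s\<close> is the identity.\<close>
  define s where "s = (\<lambda>y. (g y, \<lambda>t\<in>{0..1}. k (t, y)))"
  have contN1: "continuous_map N X fst" and contN2: "continuous_map N (path_space Y) snd"
    unfolding N_def by (auto intro: continuous_map_from_subtopology continuous_map_fst continuous_map_snd)
  have inN: "continuous_map Z N h"
    if "continuous_map Z X (fst \<circ> h)" "continuous_map Z (path_space Y) (snd \<circ> h)"
      "\<And>z. z \<in> topspace Z \<Longrightarrow> snd (h z) 0 = f (fst (h z))" for Z :: "'z topology" and h
    unfolding N_def continuous_map_in_subtopology
    using that by (auto simp: continuous_map_pairwise split_def)
  have contc: "continuous_map X N c"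
  proof (rule inN)
    have "continuous_map X (path_space Y) (\<lambda>x. \<lambda>t\<in>{0..1}. (f \<circ> snd) (t::real, x))"
      by (intro continuous_map_path_space_curry continuous_map_compose[OF continuous_map_snd f])
    then show "continuous_map X (path_space Y) (snd \<circ> c)"
      by (simp add: c_def o_def const_path_def)
  qed (simp_all add: c_def o_def const_path_def)
  have contq: "continuous_map N Y q"
    using continuous_map_path_space_eval_compose[OF _ contN2, of "\<lambda>_. 1"]
    by (simp add: q_def split_def)
  have conts: "continuous_map Y N s"
    by (rule inN) (use continuous_map_path_space_curry[OF k(1)] g k in \<open>simp_all add: s_def o_def\<close>)
  have cpi: "homotopic_with (\<lambda>_. True) N N (c \<circ> fst) id"
  proof (rule homotopic_with[THEN iffD2, rule_format, OF refl], intro exI conjI ballI)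
    \<comment> \<open>Only the initial piece of \<open>\<gamma>\<close> up to time
      \<open>\<tau>\<close> is kept: a constant path for \<open>\<tau> = 0\<close>, all of
      \<open>\<gamma>\<close> for \<open>\<tau> = 1\<close>.\<close>
    let ?h = "\<lambda>(\<tau>, x, \<gamma>). (x, \<lambda>t\<in>{0..1}. \<gamma> (\<tau> * t))"
    let ?I = "prod_topology unit_interval N"
    show "continuous_map ?I N ?h"
    proof (rule inN)
      show "continuous_map ?I X (fst \<circ> ?h)"
        using continuous_map_compose[OF continuous_map_snd contN1] by (simp add: o_def split_def)
      let ?J = "prod_topology unit_interval ?I"
      have "continuous_map ?J unit_interval fst" "continuous_map ?J unit_interval (fst \<circ> snd)"
        by (blast intro: continuous_map_fst continuous_map_snd continuous_map_compose)+
      then have "continuous_map ?J unit_interval (\<lambda>z. fst (snd z) * fst z)"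
        unfolding continuous_map_in_subtopology
        by (auto simp: o_def intro!: continuous_map_real_mult mult_le_one)
      moreover have "continuous_map ?J (path_space Y) (\<lambda>z. snd (snd (snd z)))"
        using continuous_map_compose[OF continuous_map_compose[OF continuous_map_snd continuous_map_snd] contN2]
        by (simp add: o_def)
      ultimately have "continuous_map ?J Y (\<lambda>z. snd (snd (snd z)) (fst (snd z) * fst z))"
        by (rule continuous_map_path_space_eval_compose)
      from continuous_map_path_space_curry[OF this]
      show "continuous_map ?I (path_space Y) (snd \<circ> ?h)"
        by (simp add: o_def split_def)
    qed (auto simp: N_def)
    fix z assume z: "z \<in> topspace N"
    obtain x \<gamma> where [simp]: "z = (x, \<gamma>)" by (cases z)
    have "\<gamma> \<in> extensional {0..1}" "\<gamma> 0 = f x"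
      using z by (auto simp: N_def topspace_path_space paths_def)
    then show "?h (0, z) = (c \<circ> fst) z" "?h (1, z) = id z"
      by (auto simp: c_def const_path_def fun_eq_iff extensional_def)
  qed auto
  have c: "member X N c"
    using member_deformation_retraction(1)[OF contc contN1 N] cpi
    by (simp add: c_def homotopic_with_sym)
  note [trans] = homotopic_with_trans
  have contsq: "continuous_map N N (s \<circ> q)" using contq conts continuous_map_compose by blast
  have qc: "q \<circ> c = f" by (auto simp: q_def c_def const_path_def)
  have ps: "fst \<circ> s = g" by (auto simp: s_def)
  \<comment> \<open>Inserting \<open>c \<circ> fst\<close>, which is homotopic to \<open>id\<close>,
    first on the right and then on the left turns \<open>s \<circ> q\<close> into
    \<open>c \<circ> g \<circ> f \<circ> fst\<close>, to which the homotopy \<open>gf\<close>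
    applies.\<close>
  have "homotopic_with (\<lambda>_. True) N N (s \<circ> q) (s \<circ> q \<circ> (c \<circ> fst))"
    using homotopic_compose[OF homotopic_with_symD[OF cpi], of N "s \<circ> q" "s \<circ> q"] contsq by simp
  also have "s \<circ> q \<circ> (c \<circ> fst) = s \<circ> f \<circ> fst"
    by (simp only: qc[symmetric] o_assoc)
  also have "homotopic_with (\<lambda>_. True) N N (s \<circ> f \<circ> fst) ((c \<circ> fst) \<circ> (s \<circ> f \<circ> fst))"
  proof -
    have "continuous_map N N (s \<circ> f \<circ> fst)"
      by (intro continuous_map_compose[OF contN1] continuous_map_compose[OF f] conts)
    then show ?thesis
      using homotopic_compose[OF _ homotopic_with_symD[OF cpi], of N "s \<circ> f \<circ> fst" "s \<circ> f \<circ> fst"] by simp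
  qed
  also have "(c \<circ> fst) \<circ> (s \<circ> f \<circ> fst) = c \<circ> ((g \<circ> f) \<circ> fst)"
    by (simp only: ps[symmetric] o_assoc)
  also have "homotopic_with (\<lambda>_. True) N N (c \<circ> ((g \<circ> f) \<circ> fst)) (c \<circ> (id \<circ> fst))"
    using contc contN1 by (intro homotopic_compose[OF homotopic_compose[OF _ gf]]) simp_all
  also have "c \<circ> (id \<circ> fst) = c \<circ> fst" by simp
  also note cpi
  finally have "homotopic_with (\<lambda>_. True) N N (s \<circ> q) id" .
  then have "member N Y q"
    using member_deformation_retraction(2)[OF conts contq N] k(3)
    by (simp add: s_def q_def homotopic_with_sym)
  then show ?thesis
    using member_compose[OF c] qc by metis
qed

end

section \<open>Maps out of realisations\<close>

lemma quotient_map_quotient_space: "quotient_map Z (quotient_space Z r) (\<lambda>z. r `` {z})"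
proof -
  have top: "topspace (quotient_space Z r) = topspace Z // r"
  proof (rule equalityI)
    show "topspace (quotient_space Z r) \<subseteq> topspace Z // r"
      using openin_topspace[of "quotient_space Z r"] unfolding openin_quotient_space by (rule conjunct1)
    have "{z \<in> topspace Z. r `` {z} \<in> topspace Z // r} = topspace Z"
      by (blast intro: quotientI)
    then have "openin (quotient_space Z r) (topspace Z // r)"
      by (simp add: openin_quotient_space)
    then show "topspace Z // r \<subseteq> topspace (quotient_space Z r)" by (rule openin_subset)
  qed
  show ?thesis
    unfolding quotient_map_def top
  proof (intro conjI allI impI)
    show "(\<lambda>z. r `` {z}) ` topspace Z = topspace Z // r"
      unfolding quotient_def by blast
  qed (simp add: openin_quotient_space)
qed

definition realization_point ::
  "(nat \<Rightarrow> 'a topology) \<Rightarrow> (nat \<Rightarrow> (nat \<Rightarrow> nat) \<Rightarrow> 'a \<Rightarrow> 'a)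
     \<Rightarrow> nat \<times> ('a \<times> (nat \<Rightarrow> real)) \<Rightarrow> (nat \<times> ('a \<times> (nat \<Rightarrow> real))) set" where
  "realization_point X act z = realization_rel X act `` {z}"

lemma quotient_map_realization_point:
  "quotient_map (realization_total X) (realization X act) (realization_point X act)"
  unfolding realization_def realization_point_def by (rule quotient_map_quotient_space)

lemma topspace_realization_total:
  "topspace (realization_total X) = {(n, (x, t)). x \<in> topspace (X n) \<and> t \<in> standard_simplex n}"
  by (auto simp: realization_total_def simplex_space_def topspace_standard_simplex)

lemma topspace_realization:
  "topspace (realization X act) = realization_point X act ` topspace (realization_total X)"
  using quotient_imp_surjective_map[OF quotient_map_realization_point] by blast

lemma realization_point_act:
  assumes "mono_on {..m} \<theta>" "\<theta> ` {..m} \<subseteq> {..n}" "x \<in> topspace (X n)" "t \<in> standard_simplex m"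
  shows "realization_point X act (m, (act m \<theta> x, t)) = realization_point X act (n, (x, simplex_push m \<theta> t))"
proof -
  define r where "r = {((m, (act m \<theta> x, t)), (n, (x, simplex_push m \<theta> t))) | m n \<theta> x t.
                 mono_on {..m} \<theta> \<and> \<theta> ` {..m} \<subseteq> {..n} \<and>
                 x \<in> topspace (X n) \<and> t \<in> standard_simplex m}"
  have R: "realization_rel X act = (r \<union> r\<inverse>)\<^sup>*"
    unfolding realization_rel_def Let_def r_def by blast
  let ?a = "(m, (act m \<theta> x, t))" and ?b = "(n, (x, simplex_push m \<theta> t))"
  have "(?a, ?b) \<in> r" unfolding r_def using assms by blast
  then have "(?a, ?b) \<in> (r \<union> r\<inverse>)\<^sup>*" "(?b, ?a) \<in> (r \<union> r\<inverse>)\<^sup>*" by auto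
  then show ?thesis
    unfolding realization_point_def R by (auto intro: rtrancl_trans)
qed

text \<open>Two cell points with the same class are joined by a zigzag of generating
  identifications, each of which \<open>f\<close> respects; so functions on cells descend to the
  realisation.\<close>

lemma realization_point_eq_imp:
  assumes compat: "\<And>m n \<theta> x t. \<lbrakk>mono_on {..m} \<theta>; \<theta> ` {..m} \<subseteq> {..n}; x \<in> topspace (X n);
      t \<in> standard_simplex m\<rbrakk> \<Longrightarrow> f (m, (act m \<theta> x, t)) = f (n, (x, simplex_push m \<theta> t))"
    and eq: "realization_point X act z = realization_point X act z'"
  shows "f z = f z'"
proof -
  define r where "r = {((m, (act m \<theta> x, t)), (n, (x, simplex_push m \<theta> t))) | m n \<theta> x t.
                 mono_on {..m} \<theta> \<and> \<theta> ` {..m} \<subseteq> {..n} \<and>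
                 x \<in> topspace (X n) \<and> t \<in> standard_simplex m}"
  have R: "realization_rel X act = (r \<union> r\<inverse>)\<^sup>*"
    unfolding realization_rel_def Let_def r_def by blast
  have r_eq: "f a = f b" if "(a, b) \<in> r \<union> r\<inverse>" for a b
    using that compat unfolding r_def by fastforce
  have "z' \<in> realization_point X act z"
    unfolding eq by (simp add: realization_point_def R)
  then have "(z, z') \<in> (r \<union> r\<inverse>)\<^sup>*" by (simp add: realization_point_def R)
  then show ?thesis
  proof (induction rule: rtrancl_induct)
    case (step a b)
    then show ?case using r_eq by metis
  qed simp
qed

text \<open>Each summand is open in the sum, so continuity can be tested on one summand at a time,
  even after taking the product with \<open>W\<close>.\<close>

lemma continuous_map_from_prod_sum_topology:
  assumes "\<And>i. i \<in> I \<Longrightarrow> continuous_map (prod_topology W (X i)) Y (\<lambda>(w, x). f (w, (i, x)))"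
  shows "continuous_map (prod_topology W (sum_topology X I)) Y f"
  unfolding continuous_map_def
proof (intro conjI allI impI)
  show "f \<in> topspace (prod_topology W (sum_topology X I)) \<rightarrow> topspace Y"
    using assms by (fastforce simp: continuous_map_def Pi_iff)
next
  fix V assume V: "openin Y V"
  let ?S = "{z \<in> topspace (prod_topology W (sum_topology X I)). f z \<in> V}"
  show "openin (prod_topology W (sum_topology X I)) ?S"
  proof (subst openin_subopen, intro ballI)
    fix z assume z: "z \<in> ?S"
    obtain w i x where [simp]: "z = (w, (i, x))" by (metis surj_pair)
    have wix: "w \<in> topspace W" "i \<in> I" "x \<in> topspace (X i)" "f (w, (i, x)) \<in> V"
      using z by auto
    let ?Si = "{y \<in> topspace (prod_topology W (X i)). (\<lambda>(w, x). f (w, (i, x))) y \<in> V}"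
    have "openin (prod_topology W (X i)) ?Si"
      using assms[OF wix(2)] V by (rule openin_continuous_map_preimage)
    moreover have "(w, x) \<in> ?Si" using wix by auto
    ultimately have "\<exists>U1 U2. openin W U1 \<and> openin (X i) U2 \<and> w \<in> U1 \<and> x \<in> U2 \<and> U1 \<times> U2 \<subseteq> ?Si"
      by (rule openin_prod_topology_alt[THEN iffD1, rule_format])
    then obtain U1 U2 where U: "openin W U1" "openin (X i) U2" "w \<in> U1" "x \<in> U2" "U1 \<times> U2 \<subseteq> ?Si"
      by (elim exE conjE) (rule that)
    have "openin (sum_topology X I) (Pair i ` U2)"
      using open_map_component_injection[OF wix(2), of X] U(2) by (simp add: open_map_def)
    then have "openin (prod_topology W (sum_topology X I)) (U1 \<times> Pair i ` U2)"
      using U by (simp add: openin_prod_Times_iff)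
    moreover have "z \<in> U1 \<times> Pair i ` U2" using U by auto
    moreover have "U1 \<times> Pair i ` U2 \<subseteq> ?S" using U wix by fastforce
    ultimately show "\<exists>T. openin (prod_topology W (sum_topology X I)) T \<and> z \<in> T \<and> T \<subseteq> ?S" by blast
  qed
qed

lemma continuous_map_prod_swap_middle:
  assumes "continuous_map (prod_topology (prod_topology W T) X) Y (\<lambda>((w, t), x). f (w, (x, t)))"
  shows "continuous_map (prod_topology W (prod_topology X T)) Y f"
proof -
  have "continuous_map (prod_topology W (prod_topology X T)) (prod_topology (prod_topology W T) X)
      (\<lambda>z. ((fst z, snd (snd z)), fst (snd z)))"
    by (intro continuous_map_pairedI continuous_map_fst continuous_map_snd
        continuous_map_compose[OF continuous_map_snd continuous_map_snd, unfolded o_def]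
        continuous_map_compose[OF continuous_map_snd continuous_map_fst, unfolded o_def])
  from continuous_map_compose[OF this assms] show ?thesis
    by (simp add: o_def split_def)
qed

lemma continuous_map_from_prod_sum_middle:
  assumes "\<And>i. i \<in> I \<Longrightarrow>
    continuous_map (prod_topology (prod_topology W T) (X i)) Y (\<lambda>((w, t), x). f (w, ((i, x), t)))"
  shows "continuous_map (prod_topology W (prod_topology (sum_topology X I) T)) Y f"
  using assms
  by (intro continuous_map_prod_swap_middle continuous_map_from_prod_sum_topology)
    (simp add: split_def)

lemma continuous_map_from_prod_discrete_middle:
  assumes "\<And>s. s \<in> S \<Longrightarrow> continuous_map (prod_topology W T) Y (\<lambda>(w, t). f (w, (s, t)))"
  shows "continuous_map (prod_topology W (prod_topology (discrete_topology S) T)) Y f"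
proof (rule continuous_map_prod_swap_middle)
  \<comment> \<open>A discrete space is a disjoint union of points, which reduces the claim to
    sums.\<close>
  let ?D = "sum_topology (\<lambda>_. discrete_topology {()}) S"
  have "continuous_map (prod_topology (prod_topology W T) ?D) Y (\<lambda>((w, t), (s, _)). f (w, (s, t)))"
  proof (rule continuous_map_from_prod_sum_topology)
    fix s assume "s \<in> S"
    from continuous_map_compose[OF continuous_map_fst assms[OF this]]
    show "continuous_map (prod_topology (prod_topology W T) (discrete_topology {()})) Y
        (\<lambda>(wt, x). (\<lambda>((w, t), (s, _)). f (w, (s, t))) (wt, (s, x)))"
      by (simp add: o_def split_def)
  qed
  moreover have "continuous_map (discrete_topology S) ?D (\<lambda>s. (s, ()))" by simp
  from continuous_map_compose[OF continuous_map_snd this]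
  have "continuous_map (prod_topology (prod_topology W T) (discrete_topology S))
      (prod_topology (prod_topology W T) ?D) (\<lambda>z. (fst z, (snd z, ())))"
    by (intro continuous_map_pairedI continuous_map_fst) (simp add: o_def)
  ultimately have "continuous_map (prod_topology (prod_topology W T) (discrete_topology S)) Y
      ((\<lambda>((w, t), (s, _)). f (w, (s, t))) \<circ> (\<lambda>z. (fst z, (snd z, ()))))"
    by (rule continuous_map_compose[rotated])
  then show "continuous_map (prod_topology (prod_topology W T) (discrete_topology S)) Y
      (\<lambda>((w, t), s). f (w, (s, t)))"
    by (simp add: o_def split_def)
qed

text \<open>The interval is locally compact Hausdorff, so its product with the quotient map of the
  realisation is again a quotient map. A homotopy may therefore be defined cell by cell, with
  compatibility checked at each time separately.\<close>

lemma realization_homotopy: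
  assumes cont: "\<And>n. continuous_map (prod_topology unit_interval (prod_topology (X n) (simplex_space n))) Z
      (\<lambda>(\<tau>, xt). K \<tau> (n, xt))"
    and compat: "\<And>\<tau> m n \<theta> x t. \<lbrakk>\<tau> \<in> {0..1}; mono_on {..m} \<theta>; \<theta> ` {..m} \<subseteq> {..n}; x \<in> topspace (X n);
      t \<in> standard_simplex m\<rbrakk> \<Longrightarrow> K \<tau> (m, (act m \<theta> x, t)) = K \<tau> (n, (x, simplex_push m \<theta> t))"
  obtains L where "continuous_map (prod_topology unit_interval (realization X act)) Z L"
    "\<And>\<tau> z. \<lbrakk>\<tau> \<in> {0..1}; z \<in> topspace (realization_total X)\<rbrakk> \<Longrightarrow> L (\<tau>, realization_point X act z) = K \<tau> z"
proof -
  let ?q = "realization_point X act"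
  \<comment> \<open>Any representative will do; \<open>compat\<close> makes the value independent of
    the choice.\<close>
  define L where "L = (\<lambda>(\<tau>, c). K \<tau> (SOME z. z \<in> topspace (realization_total X) \<and> ?q z = c))"
  have L: "L (\<tau>, ?q z) = K \<tau> z" if "\<tau> \<in> {0..1}" "z \<in> topspace (realization_total X)" for \<tau> z
  proof -
    let ?z = "SOME z'. z' \<in> topspace (realization_total X) \<and> ?q z' = ?q z"
    have "?q ?z = ?q z" using that by (metis (mono_tags, lifting) someI)
    with compat[OF that(1)] have "K \<tau> ?z = K \<tau> z" by (rule realization_point_eq_imp)
    then show ?thesis by (simp add: L_def)
  qed
  have "continuous_map (prod_topology unit_interval (realization_total X)) Z (\<lambda>(\<tau>, z). K \<tau> z)"
    unfolding realization_total_def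
    by (rule continuous_map_from_prod_sum_topology) (use cont in simp)
  then have "continuous_map (prod_topology unit_interval (realization_total X)) Z (L \<circ> (\<lambda>(\<tau>, z). (\<tau>, ?q z)))"
    by (rule continuous_map_eq) (auto simp: L)
  moreover have "locally_compact_space unit_interval" "Hausdorff_space unit_interval"
    by (auto simp: Hausdorff_space_subtopology compact_imp_locally_compact_space
        compact_space_subtopology)
  then have "quotient_map (prod_topology unit_interval (realization_total X))
      (prod_topology unit_interval (realization X act)) (\<lambda>(\<tau>, z). (\<tau>, ?q z))"
    by (intro quotient_map_prod_right quotient_map_realization_point) auto
  ultimately have "continuous_map (prod_topology unit_interval (realization X act)) Z L"
    using continuous_compose_quotient_map by blast
  then show thesis using L by (rule that)
qed

section \<open>Push-forward of barycentric coordinates, seen as measures\<close>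

lemma simplex_push_simplex:
  assumes t: "t \<in> standard_simplex m" and \<theta>: "\<theta> ` {..m} \<subseteq> {..n}"
  shows "simplex_push m \<theta> t \<in> standard_simplex n"
proof -
  have t0: "\<And>i. 0 \<le> t i" and t1: "sum t {..m} = 1" using t by (auto simp: standard_simplex_def)
  have eq: "{i. i \<le> m \<and> \<theta> i = j} = {i \<in> {..m}. \<theta> i = j}" for j by auto
  have "simplex_push m \<theta> t j \<le> 1" for j
    unfolding simplex_push_def t1[symmetric] by (rule sum_mono2) (use t0 in auto)
  moreover have "simplex_push m \<theta> t j = 0" if "j > n" for j
    unfolding simplex_push_def using \<theta> that by (intro sum.neutral) auto
  moreover have "sum (simplex_push m \<theta> t) {..n} = 1"
    unfolding simplex_push_def eq using sum.group[of "{..m}" "{..n}" \<theta> t] \<theta> t1 by simp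
  ultimately show ?thesis
    using t0 by (auto simp: standard_simplex_def simplex_push_def intro: sum_nonneg)
qed

text \<open>Push-forward of measures is functorial: the fibre of \<open>v \<circ> \<theta>\<close>
  over \<open>j\<close> splits according to the value of \<open>\<theta>\<close>.\<close>

lemma simplex_push_compose:
  assumes "\<theta> ` {..m} \<subseteq> {..n}"
  shows "simplex_push n v (simplex_push m \<theta> t) = simplex_push m (v \<circ> \<theta>) t"
proof
  fix j
  let ?S = "{l. l \<le> m \<and> v (\<theta> l) = j}"
  have "simplex_push n v (simplex_push m \<theta> t) j =
      (\<Sum>i\<in>{i. i \<le> n \<and> v i = j}. \<Sum>l\<in>{l \<in> ?S. \<theta> l = i}. t l)"
    unfolding simplex_push_def by (intro sum.cong) auto
  also have "\<dots> = sum t ?S"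
    using assms by (intro sum.group) auto
  finally show "simplex_push n v (simplex_push m \<theta> t) j = simplex_push m (v \<circ> \<theta>) t j"
    by (simp add: simplex_push_def)
qed

lemma simplex_push_below:
  assumes "\<And>i. i \<le> m \<Longrightarrow> l \<le> \<theta> i" "j < l"
  shows "simplex_push m \<theta> t j = 0"
  unfolding simplex_push_def using assms by (intro sum.neutral) fastforce

lemma simplex_push_cong:
  assumes "\<And>i. i \<le> m \<Longrightarrow> \<theta> i = \<theta>' i"
  shows "simplex_push m \<theta> = simplex_push m \<theta>'"
proof -
  have "{i. i \<le> m \<and> \<theta> i = j} = {i. i \<le> m \<and> \<theta>' i = j}" for j using assms by auto
  then show ?thesis by (simp add: simplex_push_def fun_eq_iff)
qed

lemma simplex_push_shift:
  assumes "t \<in> standard_simplex m"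
  shows "simplex_push m (\<lambda>i. d + i) t = (\<lambda>j. if j < d then 0 else t (j - d))"
proof
  fix j
  have "{i. i \<le> m \<and> d + i = j} = (if d \<le> j \<and> j - d \<le> m then {j - d} else {})"
    by auto
  then show "simplex_push m (\<lambda>i. d + i) t j = (if j < d then 0 else t (j - d))"
    using assms by (auto simp: simplex_push_def standard_simplex_def)
qed

text \<open>Turns a measure on the levels \<open>l..M\<close> into barycentric coordinates on the
  simplex with these levels as vertices, which is how \<open>tele_point\<close> reads it.\<close>

lemma simplex_shift_simplex:
  assumes "\<mu> \<in> standard_simplex M" "\<And>i. i < l \<Longrightarrow> \<mu> i = 0" "l \<le> M"
  shows "(\<lambda>j. \<mu> (l + j)) \<in> standard_simplex (M - l)"
proof -
  have "sum (\<lambda>j. \<mu> (l + j)) {..M - l} = sum \<mu> {l..M}"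
    using assms(3) sum.shift_bounds_cl_nat_ivl[of \<mu> 0 l "M - l"] by (simp add: atLeast0AtMost add.commute)
  also have "\<dots> = sum \<mu> {..M}"
    using assms by (intro sum.mono_neutral_left) auto
  also have "\<dots> = 1" using assms(1) by (simp add: standard_simplex_def)
  finally have "sum (\<lambda>j. \<mu> (l + j)) {..M - l} = 1" .
  then show ?thesis using assms(1,3) by (auto simp: standard_simplex_def)
qed

lemma simplex_convex:
  assumes "x \<in> standard_simplex p" "y \<in> standard_simplex p" "\<tau> \<in> {0..1}"
  shows "(\<lambda>i. (1 - \<tau>) * x i + \<tau> * y i) \<in> standard_simplex p"
  using convex_standard_simplex[of x p y \<tau>] assms by auto

lemma continuous_map_simplex_space_coordinate:
  assumes "continuous_map Z (simplex_space m) t"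
  shows "continuous_map Z euclideanreal (\<lambda>z. t z j)"
  using assms unfolding simplex_space_def continuous_map_in_subtopology
    continuous_map_componentwise_UNIV by blast

lemma continuous_map_simplex_push:
  assumes "continuous_map Z (simplex_space m) t"
  shows "continuous_map Z euclideanreal (\<lambda>z. simplex_push m \<theta> (t z) j)"
  unfolding simplex_push_def
  using continuous_map_simplex_space_coordinate[OF assms] by (intro continuous_intros) auto

lemma continuous_map_into_simplex_space:
  assumes "\<And>j. continuous_map Z euclideanreal (\<lambda>z. t z j)"
    "\<And>z. z \<in> topspace Z \<Longrightarrow> t z \<in> standard_simplex m"
  shows "continuous_map Z (simplex_space m) t"
  unfolding simplex_space_def
  by (rule continuous_map_into_subtopology)
    (use assms in \<open>simp_all add: continuous_map_componentwise_UNIV Pi_iff\<close>)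

section \<open>The classifying space of the natural numbers\<close>

text \<open>Axiom (4) admits only index categories with objects and arrows in \<open>'u\<close>, so
  pairs of naturals are coded there.\<close>

locale omega_code =
  fixes code :: "nat \<times> nat \<Rightarrow> 'u"
  assumes inj_code: "inj code"
begin

abbreviation decode :: "'u \<Rightarrow> nat \<times> nat" where
  "decode \<equiv> inv_into UNIV code"

text \<open>This is the poset of natural numbers. An object is identified with its identity arrow,
  which is why \<open>ide\<close> is the identity function.\<close>

definition omega :: "('u, 'u) cat" where
  "omega = cat.make (range (\<lambda>n. code (n, n))) (code ` {(m, n). m \<le> n})
     (\<lambda>f. code (fst (decode f), fst (decode f))) (\<lambda>f. code (snd (decode f), snd (decode f)))
     (\<lambda>a. a) (\<lambda>g f. code (fst (decode f), snd (decode g)))"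

text \<open>The diagram is the sequence \<open>X \<rightarrow> X \<rightarrow> ...\<close> with
  every step equal to \<open>a\<close>, so an arrow acts by the iterate given by its length.\<close>

definition arrow_power :: "('a \<Rightarrow> 'a) \<Rightarrow> 'u \<Rightarrow> 'a \<Rightarrow> 'a" where
  "arrow_power a f = a ^^ (snd (decode f) - fst (decode f))"

lemma decode_code [simp]: "decode (code mn) = mn"
  using inj_code by simp

lemma code_eq_iff [simp]: "code mn = code mn' \<longleftrightarrow> mn = mn'"
  using inj_code by (simp add: inj_eq)

lemma arrow_power_code [simp]: "arrow_power a (code (m, n)) = a ^^ (n - m)"
  by (simp add: arrow_power_def)

lemma omega_simps [simp]:
  "Ob omega = range (\<lambda>n. code (n, n))" "Ar omega = code ` {(m, n). m \<le> n}"
  "src omega (code (m, n)) = code (m, m)" "tgt omega (code (m, n)) = code (n, n)"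
  "ide omega x = x" "cmp omega (code (m', n')) (code (m, n)) = code (m, n')"
  by (simp_all add: omega_def cat.make_def)

lemma category_omega: "category omega"
  unfolding category_def by auto

lemma diagram_omega:
  assumes "continuous_map X X a"
  shows "diagram omega (\<lambda>_. X) (arrow_power a)"
proof -
  have pow: "continuous_map X X (a ^^ n)" for n
  proof (induction n)
    case (Suc n)
    then show ?case using continuous_map_compose[OF Suc assms] by (simp add: o_def)
  qed (simp add: id_def)
  have add: "(a ^^ (n - l)) x = (a ^^ (n - m)) ((a ^^ (m - l)) x)" if "l \<le> m" "m \<le> n" for l m n x
    using that funpow_add[of "n - m" "m - l" a] by simp
  show ?thesis
    unfolding diagram_def
  proof (intro conjI ballI impI)
    fix f assume f: "f \<in> Ar omega"
    show "continuous_map X X (arrow_power a f)"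
      unfolding arrow_power_def by (rule pow)
    fix g x assume g: "g \<in> Ar omega" and fg: "tgt omega f = src omega g"
    from f obtain l m where f': "f = code (l, m)" "l \<le> m" by auto
    from g obtain m' n where g': "g = code (m', n)" "m' \<le> n" by auto
    have "m' = m" using fg by (simp add: f' g')
    then show "arrow_power a (cmp omega g f) x = arrow_power a g (arrow_power a f x)"
      using add[of l m n x] f'(2) g'(2) by (simp add: f'(1) g'(1))
  next
    fix c x assume "c \<in> Ob omega"
    then show "arrow_power a (ide omega c) x = x" by auto
  qed
qed

definition chain :: "nat \<Rightarrow> (nat \<Rightarrow> nat) \<Rightarrow> nat \<times> nat \<Rightarrow> 'u" where
  "chain k v = restrict (\<lambda>(i, j). code (v i, v j)) {(i, j). i \<le> j \<and> j \<le> k}"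

definition level :: "(nat \<times> nat \<Rightarrow> 'u) \<Rightarrow> nat \<Rightarrow> nat" where
  "level s i = fst (decode (s (i, i)))"

lemma chain_apply [simp]: "i \<le> j \<Longrightarrow> j \<le> k \<Longrightarrow> chain k v (i, j) = code (v i, v j)"
  by (simp add: chain_def)

lemma level_chain [simp]: "i \<le> k \<Longrightarrow> level (chain k v) i = v i"
  by (simp add: level_def)

lemma chain_cong: "(\<And>i. i \<le> k \<Longrightarrow> v i = w i) \<Longrightarrow> chain k v = chain k w"
  unfolding chain_def by (intro restrict_ext) auto

lemma chain_in_nerve:
  assumes "mono_on {..k} v"
  shows "chain k v \<in> nerve omega k"
  unfolding nerve_def
proof (intro CollectI conjI allI impI)
  show "chain k v \<in> extensional {(i, j). i \<le> j \<and> j \<le> k}" by (simp add: chain_def)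
  fix i j assume ij: "i \<le> j \<and> j \<le> k"
  then have "v i \<le> v j" using assms by (auto simp: mono_on_def)
  then show "chain k v (i, j) \<in> Ar omega" using ij by auto
  show "src omega (chain k v (i, j)) = src omega (chain k v (i, i))"
    "tgt omega (chain k v (i, j)) = src omega (chain k v (j, j))" using ij by auto
qed auto

text \<open>In a poset a simplex of the nerve is determined by its vertices, so \<open>level\<close>
  loses no information and \<open>chain\<close> recovers the simplex.\<close>

lemma in_nerveD:
  assumes "s \<in> nerve omega k"
  shows "mono_on {..k} (level s)" "chain k (level s) = s"
proof -
  have ext: "s \<in> extensional {(i, j). i \<le> j \<and> j \<le> k}"
    and ide: "\<And>i. i \<le> k \<Longrightarrow> \<exists>a\<in>Ob omega. s (i, i) = ide omega a"
    and edges: "\<And>i j. i \<le> j \<Longrightarrow> j \<le> k \<Longrightarrow> s (i, j) \<in> Ar omega \<and>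
      src omega (s (i, j)) = src omega (s (i, i)) \<and> tgt omega (s (i, j)) = src omega (s (j, j))"
    using assms unfolding nerve_def by blast+
  have diag: "s (i, i) = code (level s i, level s i)" if "i \<le> k" for i
    using ide[OF that] by (auto simp: level_def)
  have arr: "s (i, j) = code (level s i, level s j) \<and> level s i \<le> level s j" if ij: "i \<le> j" "j \<le> k" for i j
  proof -
    have s: "s (i, j) \<in> Ar omega" "src omega (s (i, j)) = src omega (s (i, i))"
      "tgt omega (s (i, j)) = src omega (s (j, j))"
      using edges[OF ij] by simp_all
    from s(1) obtain m n where mn: "s (i, j) = code (m, n)" "m \<le> n" by auto
    have "m = level s i" "n = level s j"
      using s(2,3) diag[of i] diag[of j] ij unfolding mn by simp_all
    then show ?thesis using mn by simp
  qed
  show "mono_on {..k} (level s)" using arr by (auto intro!: mono_onI)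
  show "chain k (level s) = s"
    using ext arr by (intro extensionalityI[of _ "{(i, j). i \<le> j \<and> j \<le> k}"]) (auto simp: chain_def)
qed

lemma nerve_act_chain:
  assumes "mono_on {..m} \<theta>" "\<theta> ` {..m} \<subseteq> {..n}"
  shows "nerve_act m \<theta> (chain n v) = chain m (v \<circ> \<theta>)"
  unfolding nerve_act_def
proof (subst (2) chain_def, intro restrict_ext)
  fix ij assume "ij \<in> {(i, j). i \<le> j \<and> j \<le> m}"
  moreover then have "\<theta> (fst ij) \<le> \<theta> (snd ij)" "\<theta> (snd ij) \<le> n"
    using assms by (auto simp: mono_on_def)
  ultimately show "(case ij of (i, j) \<Rightarrow> chain n v (\<theta> i, \<theta> j)) = (case ij of (i, j) \<Rightarrow> code ((v \<circ> \<theta>) i, (v \<circ> \<theta>) j))"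
    by auto
qed

abbreviation nerve_point :: "nat \<times> ((nat \<times> nat \<Rightarrow> 'u) \<times> (nat \<Rightarrow> real)) \<Rightarrow> _" where
  "nerve_point \<equiv> realization_point (\<lambda>n. discrete_topology (nerve omega n)) nerve_act"

lemma mono_add: "mono_on S (\<lambda>i. l + i :: nat)"
  by (auto intro: mono_onI)

text \<open>The vertex function \<open>v\<close>, used as a simplicial operator, takes the full
  chain \<open>0..M\<close> to \<open>chain k v\<close>. Hence, for a given bound \<open>M\<close>,
  the point depends only on the measure that its coordinates induce on the levels.\<close>

lemma nerve_point_chain:
  assumes v: "mono_on {..k} v" "v k \<le> M" and t: "t \<in> standard_simplex k"
  shows "nerve_point (k, (chain k v, t)) = nerve_point (M, (chain M id, simplex_push k v t))"
proof -
  have im: "v ` {..k} \<subseteq> {..M}"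
    using v by (auto simp: mono_on_def intro: order_trans)
  have "nerve_act k v (chain M id) = chain k v"
    using nerve_act_chain[OF v(1) im, of id] by simp
  moreover have "chain M id \<in> topspace (discrete_topology (nerve omega M))"
    by (simp add: chain_in_nerve mono_onI)
  ultimately show ?thesis
    using realization_point_act[OF v(1) im _ t,
        where X = "\<lambda>n. discrete_topology (nerve omega n)" and act = nerve_act and x = "chain M id"]
    by simp
qed

lemma level_mono:
  assumes "s \<in> nerve omega n" "i \<le> j" "j \<le> n"
  shows "level s i \<le> level s j"
  using in_nerveD(1)[OF assms(1)] assms by (auto simp: mono_on_def)

lemma nerve_act_in_nerve:
  assumes \<theta>: "mono_on {..m} \<theta>" "\<theta> ` {..m} \<subseteq> {..n}" and s: "s \<in> nerve omega n"
  shows "nerve_act m \<theta> s \<in> nerve omega m"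
proof -
  have "level s (\<theta> i) \<le> level s (\<theta> j)" if "i \<le> j" "j \<le> m" for i j
    using \<theta> that by (intro level_mono[OF s]) (auto simp: mono_on_def)
  then have "chain m (level s \<circ> \<theta>) \<in> nerve omega m"
    by (intro chain_in_nerve mono_onI) auto
  then show ?thesis
    using nerve_act_chain[OF \<theta>, of "level s"] in_nerveD(2)[OF s] by simp
qed

lemma level_act:
  assumes "mono_on {..m} \<theta>" "\<theta> ` {..m} \<subseteq> {..n}" "s \<in> nerve omega n" "i \<le> m"
  shows "level (nerve_act m \<theta> s) i = level s (\<theta> i)"
  using assms nerve_act_chain[OF assms(1,2), of "level s"] in_nerveD[OF assms(3)]
  by (metis comp_apply level_chain)

lemma nonempty_classifying_space_omega: "topspace (classifying_space omega) \<noteq> {}"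
proof -
  have "chain 0 id \<in> nerve omega 0" by (simp add: chain_in_nerve mono_onI)
  then have "(0, (chain 0 id, \<lambda>j. if j = 0 then 1 else 0)) \<in>
      topspace (realization_total (\<lambda>n. discrete_topology (nerve omega n)))"
    by (simp add: topspace_realization_total)
  then show ?thesis
    unfolding classifying_space_def topspace_realization by blast
qed

text \<open>In a full chain \<open>0..M\<close> the measure of a point is joined by a segment to the
  point mass \<open>\<delta>\<close> at level \<open>0\<close>; these segments contract the whole
  space to that vertex.\<close>

lemma contractible_classifying_space_omega: "contractible_space (classifying_space omega)"
proof -
  define \<delta> :: "nat \<Rightarrow> real" where "\<delta> = (\<lambda>j. if j = 0 then 1 else 0)"
  define w where "w = (\<lambda>\<tau> k s t i. (1 - \<tau>) * simplex_push k (level s) t i + \<tau> * \<delta> i)"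
  define K where "K = (\<lambda>\<tau> (k, (s, t)). nerve_point (level s k, (chain (level s k) id, w \<tau> k s t)))"
  let ?X = "\<lambda>n. discrete_topology (nerve omega n)"
  have \<delta>: "\<delta> \<in> standard_simplex n" for n unfolding \<delta>_def by simp
  have w: "w \<tau> k s t \<in> standard_simplex (level s k)"
    if "\<tau> \<in> {0..1}" "s \<in> nerve omega k" "t \<in> standard_simplex k" for \<tau> k s t
    unfolding w_def using that level_mono[OF that(2)]
    by (intro simplex_convex simplex_push_simplex \<delta>) auto
  \<comment> \<open>Enlarging the bound does not change the point; this absorbs the choice of
    \<open>level s k\<close> in \<open>K\<close>.\<close>
  have stab: "nerve_point (N, (chain N id, \<mu>)) = nerve_point (M, (chain M id, \<mu>))"
    if \<mu>: "\<mu> \<in> standard_simplex N" and NM: "N \<le> M" for N M \<mu>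
  proof -
    have "nerve_point (N, (chain N id, \<mu>)) = nerve_point (M, (chain M id, simplex_push N id \<mu>))"
      using NM \<mu> by (intro nerve_point_chain) (auto intro: mono_onI)
    moreover have "simplex_push N id \<mu> = \<mu>"
      using simplex_push_shift[OF \<mu>, of 0] by (simp add: id_def)
    ultimately show ?thesis by simp
  qed
  obtain L where L: "continuous_map (prod_topology unit_interval (classifying_space omega)) (classifying_space omega) L"
    and LK: "\<And>\<tau> z. \<lbrakk>\<tau> \<in> {0..1}; z \<in> topspace (realization_total ?X)\<rbrakk> \<Longrightarrow> L (\<tau>, nerve_point z) = K \<tau> z"
    unfolding classifying_space_def
  proof (rule realization_homotopy[of ?X "realization ?X nerve_act" K nerve_act])
    fix k
    let ?D = "simplex_space k"
    show "continuous_map (prod_topology unit_interval (prod_topology (?X k) ?D))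
       (realization ?X nerve_act) (\<lambda>(\<tau>, xt). K \<tau> (k, xt))"
    proof (rule continuous_map_from_prod_discrete_middle)
      fix s assume s: "s \<in> nerve omega k"
      let ?P = "prod_topology unit_interval ?D" and ?N = "level s k"
      have "continuous_map ?P euclideanreal fst"
        using continuous_map_fst[of unit_interval ?D] unfolding continuous_map_in_subtopology by blast
      then have "continuous_map ?P (simplex_space ?N) (\<lambda>z. w (fst z) k s (snd z))"
        using w[OF _ s] unfolding w_def
        by (intro continuous_map_into_simplex_space continuous_intros continuous_map_simplex_push
            continuous_map_snd) (auto simp: simplex_space_def topspace_standard_simplex)
      moreover have "chain ?N id \<in> nerve omega ?N" by (simp add: chain_in_nerve mono_onI)
      ultimately have "continuous_map ?P (prod_topology (?X ?N) (simplex_space ?N))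
          (\<lambda>z. (chain ?N id, w (fst z) k s (snd z)))"
        by (intro continuous_map_pairedI) auto
      moreover have "continuous_map (prod_topology (?X ?N) (simplex_space ?N)) (realization_total ?X) (Pair ?N)"
        unfolding realization_total_def by (rule continuous_map_component_injection) simp
      ultimately have "continuous_map ?P (realization ?X nerve_act)
          (nerve_point \<circ> (Pair ?N \<circ> (\<lambda>z. (chain ?N id, w (fst z) k s (snd z)))))"
        by (intro continuous_map_compose[OF _ quotient_imp_continuous_map[OF quotient_map_realization_point]]
            continuous_map_compose)
      then show "continuous_map ?P (realization ?X nerve_act)
          (\<lambda>(\<tau>, t). (\<lambda>(\<tau>, xt). K \<tau> (k, xt)) (\<tau>, (s, t)))"
        by (simp add: K_def o_def split_def)
    qed
  next
    fix \<tau> :: real and m n :: nat and \<theta> s t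
    assume \<tau>: "\<tau> \<in> {0..1}" and \<theta>: "mono_on {..m} \<theta>" "\<theta> ` {..m} \<subseteq> {..n}"
      and "s \<in> topspace (discrete_topology (nerve omega n))" and t: "t \<in> standard_simplex m"
    then have s: "s \<in> nerve omega n" by simp
    let ?s = "nerve_act m \<theta> s"
    have "simplex_push m (level ?s) t = simplex_push n (level s) (simplex_push m \<theta> t)"
      unfolding simplex_push_compose[OF \<theta>(2)]
      using level_act[OF \<theta> s] by (intro fun_cong[OF simplex_push_cong]) auto
    then have weq: "w \<tau> m ?s t = w \<tau> n s (simplex_push m \<theta> t)"
      by (simp add: w_def)
    \<comment> \<open>The operator preserves the pushed measure but may lower the top level, which
      \<open>K\<close> uses as its bound.\<close>
    have "level ?s m = level s (\<theta> m)" using level_act[OF \<theta> s, of m] by simp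
    also have "\<dots> \<le> level s n" using \<theta> by (intro level_mono[OF s]) auto
    finally have le: "level ?s m \<le> level s n" .
    have "?s \<in> nerve omega m"
      by (rule nerve_act_in_nerve[OF \<theta> s])
    from stab[OF w[OF \<tau> this t] le]
    show "K \<tau> (m, (?s, t)) = K \<tau> (n, (s, simplex_push m \<theta> t))"
      by (simp add: K_def weq)
  qed blast
  define c where "c = nerve_point (0, (chain 0 id, \<delta>))"
  have "homotopic_with (\<lambda>_. True) (classifying_space omega) (classifying_space omega) id (\<lambda>_. c)"
  proof (rule iffD2[OF homotopic_with], simp, intro exI conjI ballI)
    show "continuous_map (prod_topology unit_interval (classifying_space omega)) (classifying_space omega) L"
      by (rule L)
    fix y assume "y \<in> topspace (classifying_space omega)"
    then obtain k s t where y: "y = nerve_point (k, (s, t))"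
      and z: "(k, (s, t)) \<in> topspace (realization_total ?X)"
      unfolding classifying_space_def topspace_realization by auto
    then have s: "s \<in> nerve omega k" and t: "t \<in> standard_simplex k"
      by (simp_all add: topspace_realization_total)
    have "L (0, y) = nerve_point (level s k, (chain (level s k) id, simplex_push k (level s) t))"
      using LK[OF _ z, of 0] by (simp add: y K_def w_def)
    also have "\<dots> = y"
      using nerve_point_chain[OF in_nerveD(1)[OF s] order_refl t] in_nerveD(2)[OF s] by (simp add: y)
    finally show "L (0, y) = id y" by simp
    show "L (1, y) = c"
      using LK[OF _ z, of 1] stab[OF \<delta>, of 0 "level s k"] by (simp add: y K_def w_def c_def)
  qed simp
  then show ?thesis unfolding contractible_space_def by blast
qed

end

section \<open>Telescopes\<close>

definition shift_measure :: "nat \<Rightarrow> (nat \<Rightarrow> real) \<Rightarrow> nat \<Rightarrow> real" where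
  "shift_measure d \<mu> = (\<lambda>j. if j < d then 0 else \<mu> (j - d))"

lemma shift_measure_0 [simp]: "shift_measure 0 \<mu> = \<mu>"
  by (simp add: shift_measure_def)

lemma shift_measure_simplex:
  assumes "\<mu> \<in> standard_simplex M"
  shows "shift_measure d \<mu> \<in> standard_simplex (M + d)"
proof -
  have "simplex_push M (\<lambda>i. d + i) \<mu> \<in> standard_simplex (M + d)"
    using assms by (intro simplex_push_simplex) auto
  then show ?thesis by (simp add: simplex_push_shift[OF assms] shift_measure_def)
qed

text \<open>The level \<open>l\<close> is only a lower bound of the support of \<open>\<mu>\<close>,
  not its minimum: along a homotopy of measures the support varies while \<open>l\<close> has to
  stay fixed.\<close>

definition tele_coords :: "'a topology \<Rightarrow> nat \<Rightarrow> nat \<Rightarrow> 'a \<Rightarrow> (nat \<Rightarrow> real) \<Rightarrow> bool" where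
  "tele_coords X l M x \<mu> \<longleftrightarrow>
     l \<le> M \<and> x \<in> topspace X \<and> \<mu> \<in> standard_simplex M \<and> (\<forall>i<l. \<mu> i = 0)"

lemma tele_coords_shift:
  assumes "tele_coords X l M x \<mu>" "x' \<in> topspace Y"
  shows "tele_coords Y (l + d) (M + d) x' (shift_measure d \<mu>)"
  using assms shift_measure_simplex by (auto simp: tele_coords_def) (simp add: shift_measure_def)

section \<open>Coordinates on the telescope\<close>

context omega_code
begin

abbreviation telescope :: "'a topology \<Rightarrow> ('a \<Rightarrow> 'a) \<Rightarrow> _" where
  "telescope X a \<equiv> hocolim omega (\<lambda>_. X) (arrow_power a)"

abbreviation cell_point :: "'a topology \<Rightarrow> ('a \<Rightarrow> 'a) \<Rightarrow> _" where
  "cell_point X a \<equiv> realization_point (simplicial_replacement omega (\<lambda>_. X)) (simplicial_replacement_act (arrow_power a))"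

text \<open>A point of the telescope is given by a probability measure \<open>\<mu>\<close> on \<open>{l..M}\<close> and a point of the
  space sitting at level \<open>l\<close>; neither the bound \<open>M\<close> nor the choice of a level \<open>l\<close> below the support
  matters, if the point is moved along (lemmas \<open>tele_point_bound\<close> and \<open>tele_point_slide\<close>).\<close>

definition tele_point ::
  "'a topology \<Rightarrow> ('a \<Rightarrow> 'a) \<Rightarrow> nat \<Rightarrow> nat \<Rightarrow> 'a \<Rightarrow> (nat \<Rightarrow> real)
    \<Rightarrow> (nat \<times> (((nat \<times> nat \<Rightarrow> 'u) \<times> 'a) \<times> (nat \<Rightarrow> real))) set" where
  "tele_point X a l M x \<mu> = cell_point X a (M - l, ((chain (M - l) (\<lambda>i. l + i), x), \<lambda>j. \<mu> (l + j)))"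

lemma topspace_simplicial_replacement:
  "topspace (simplicial_replacement omega (\<lambda>_. X) k) = nerve omega k \<times> topspace X"
  by (auto simp: simplicial_replacement_def)

lemma chain_act:
  assumes "mono_on {..m} \<theta>" "\<theta> ` {..m} \<subseteq> {..n}"
  shows "simplicial_replacement_act (arrow_power a) m \<theta> (chain n v, x) =
    (chain m (v \<circ> \<theta>), (a ^^ (v (\<theta> 0) - v 0)) x)"
proof -
  have "\<theta> 0 \<le> n" using assms(2) by auto
  then show ?thesis
    by (simp add: simplicial_replacement_act_def nerve_act_chain[OF assms])
qed

text \<open>Counted from \<open>v 0\<close>, the vertices of the chain define an operator into the
  full chain \<open>v 0, ..., M\<close>. It fixes the first vertex, so \<open>x\<close> is not moved
  by any power of \<open>a\<close>.\<close>

lemma cell_point_chain: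
  assumes v: "mono_on {..k} v" "v k \<le> M" and x: "x \<in> topspace X" and t: "t \<in> standard_simplex k"
  shows "cell_point X a (k, ((chain k v, x), t)) = tele_point X a (v 0) M x (simplex_push k v t)"
proof -
  let ?\<theta> = "\<lambda>i. v i - v 0" and ?n = "M - v 0"
  have v0: "v 0 \<le> v i" "v i \<le> M" if "i \<le> k" for i
    using that v by (auto simp: mono_on_def intro: order_trans)
  have \<theta>: "mono_on {..k} ?\<theta>" "?\<theta> ` {..k} \<subseteq> {..?n}"
    using v v0 by (auto simp: mono_on_def intro!: diff_le_mono)
  have "chain k ((\<lambda>i. v 0 + i) \<circ> ?\<theta>) = chain k v"
    using v0 by (intro chain_cong) simp
  then have act: "simplicial_replacement_act (arrow_power a) k ?\<theta> (chain ?n (\<lambda>i. v 0 + i), x) = (chain k v, x)"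
    using chain_act[OF \<theta>, of a "\<lambda>i. v 0 + i" x] by simp
  have "{i. i \<le> k \<and> v i - v 0 = j} = {i. i \<le> k \<and> v i = v 0 + j}" for j
    using v0 by fastforce
  then have push: "simplex_push k ?\<theta> t = (\<lambda>j. simplex_push k v t (v 0 + j))"
    by (simp add: simplex_push_def fun_eq_iff)
  have "(chain ?n (\<lambda>i. v 0 + i), x) \<in> topspace (simplicial_replacement omega (\<lambda>_. X) ?n)"
    using x by (simp add: topspace_simplicial_replacement chain_in_nerve mono_add)
  from realization_point_act[where X = "simplicial_replacement omega (\<lambda>_. X)"
      and act = "simplicial_replacement_act (arrow_power a)", OF \<theta> this t]
  show ?thesis by (simp add: act push tele_point_def)
qed

text \<open>The chain \<open>l..M\<close> is read inside the longer chain \<open>l..M'\<close> by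
  means of \<open>cell_point_chain\<close>.\<close>

lemma tele_point_bound:
  assumes "tele_coords X l M x \<mu>" "M \<le> M'"
  shows "tele_point X a l M x \<mu> = tele_point X a l M' x \<mu>"
proof -
  have l: "l \<le> M" "x \<in> topspace X" "\<mu> \<in> standard_simplex M" "\<And>i. i < l \<Longrightarrow> \<mu> i = 0"
    using assms by (auto simp: tele_coords_def)
  have t: "(\<lambda>j. \<mu> (l + j)) \<in> standard_simplex (M - l)"
    using l by (intro simplex_shift_simplex) auto
  have "simplex_push (M - l) (\<lambda>i. l + i) (\<lambda>j. \<mu> (l + j)) = \<mu>"
    unfolding simplex_push_shift[OF t] using l(4) by auto
  with cell_point_chain[OF mono_add _ l(2) t, of l M' a] l(1) assms(2)
  show ?thesis by (simp add: tele_point_def)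
qed

text \<open>The operator \<open>?\<theta>\<close> omits the vertices \<open>l, ..., l' - 1\<close>,
  which carry no mass. It moves the first vertex from \<open>l\<close> to \<open>l'\<close>, so the
  simplicial replacement applies \<open>l' - l\<close> steps of \<open>a\<close>.\<close>

lemma tele_point_slide:
  assumes "tele_coords X l M x \<mu>" "l \<le> l'" "l' \<le> M" "\<And>i. i < l' \<Longrightarrow> \<mu> i = 0"
  shows "tele_point X a l M x \<mu> = tele_point X a l' M ((a ^^ (l' - l)) x) \<mu>"
proof -
  let ?\<theta> = "\<lambda>i. (l' - l) + i"
  have l: "l \<le> M" "x \<in> topspace X" "\<mu> \<in> standard_simplex M"
    using assms by (auto simp: tele_coords_def)
  have t: "(\<lambda>j. \<mu> (l' + j)) \<in> standard_simplex (M - l')"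
    using l assms by (intro simplex_shift_simplex) auto
  have \<theta>: "mono_on {..M - l'} ?\<theta>" by (rule mono_add)
  have \<theta>im: "?\<theta> ` {..M - l'} \<subseteq> {..M - l}"
  proof (rule image_subsetI)
    fix i assume "i \<in> {..M - l'}"
    then have "i \<le> M - l'" by simp
    then have "(l' - l) + i \<le> M - l" using assms(2,3) by linarith
    then show "(l' - l) + i \<in> {..M - l}" by simp
  qed
  have "(\<lambda>i. l + i) \<circ> ?\<theta> = (\<lambda>i. l' + i)" using assms(2) by auto
  then have act: "simplicial_replacement_act (arrow_power a) (M - l') ?\<theta> (chain (M - l) (\<lambda>i. l + i), x) =
      (chain (M - l') (\<lambda>i. l' + i), (a ^^ (l' - l)) x)"
    using chain_act[OF \<theta> \<theta>im, of a "\<lambda>i. l + i" x] by simp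
  have push: "simplex_push (M - l') ?\<theta> (\<lambda>j. \<mu> (l' + j)) = (\<lambda>j. \<mu> (l + j))"
    unfolding simplex_push_shift[OF t] using assms(2,4) by (auto simp: fun_eq_iff add.commute)
  have "(chain (M - l) (\<lambda>i. l + i), x) \<in> topspace (simplicial_replacement omega (\<lambda>_. X) (M - l))"
    using l by (simp add: topspace_simplicial_replacement chain_in_nerve mono_add)
  from realization_point_act[where X = "simplicial_replacement omega (\<lambda>_. X)"
      and act = "simplicial_replacement_act (arrow_power a)", OF \<theta> \<theta>im this t]
  show ?thesis by (simp add: act push tele_point_def)
qed

lemma tele_point_cases:
  assumes "y \<in> topspace (telescope X a)"
  obtains l M x \<mu> where "tele_coords X l M x \<mu>" "y = tele_point X a l M x \<mu>"
proof -
  obtain k s x t where y: "y = cell_point X a (k, ((s, x), t))"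
    and s: "s \<in> nerve omega k" and x: "x \<in> topspace X" and t: "t \<in> standard_simplex k"
    using assms unfolding hocolim_def topspace_realization
    by (auto simp: topspace_realization_total topspace_simplicial_replacement)
  have "simplex_push k (level s) t \<in> standard_simplex (level s k)"
    using level_mono[OF s] t by (intro simplex_push_simplex) auto
  moreover have "simplex_push k (level s) t i = 0" if "i < level s 0" for i
    using level_mono[OF s] that by (intro simplex_push_below[where l = "level s 0"]) auto
  ultimately have "tele_coords X (level s 0) (level s k) x (simplex_push k (level s) t)"
    using level_mono[OF s, of 0 k] x by (simp add: tele_coords_def)
  moreover have "y = tele_point X a (level s 0) (level s k) x (simplex_push k (level s) t)"
    using cell_point_chain[OF in_nerveD(1)[OF s] order_refl x t, of a] in_nerveD(2)[OF s] by (simp add: y)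
  ultimately show thesis by (rule that)
qed

text \<open>One construction serves twice: \<open>d = e\<close> produces maps of telescopes, and
  \<open>d = 0\<close>, \<open>e = 1\<close> the homotopy between identity and shift. Since
  \<open>d \<le> e\<close>, both shifted measures live on the levels
  \<open>l + d, ..., M + e\<close>, so their convex combinations are coordinates over one fixed
  cell.\<close>

lemma telescope_homotopy:
  assumes a: "continuous_map X X a" and f: "continuous_map X Y f"
    and comm: "\<And>x. x \<in> topspace X \<Longrightarrow> f (a x) = b (f x)" and de: "d \<le> e"
  obtains L where "continuous_map (prod_topology unit_interval (telescope X a)) (telescope Y b) L"
    "\<And>\<tau> l M x \<mu>. \<lbrakk>\<tau> \<in> {0..1}; tele_coords X l M x \<mu>\<rbrakk> \<Longrightarrow> L (\<tau>, tele_point X a l M x \<mu>) =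
      tele_point Y b (l + d) (M + e) (f x) (\<lambda>i. (1 - \<tau>) * shift_measure d \<mu> i + \<tau> * shift_measure e \<mu> i)"
proof -
  define w where "w = (\<lambda>\<tau> k s t i. (1 - \<tau>) * simplex_push k (\<lambda>i. d + level s i) t i
    + \<tau> * simplex_push k (\<lambda>i. e + level s i) t i)"
  define K where "K = (\<lambda>\<tau> (k, ((s, x), t)). tele_point Y b (level s 0 + d) (level s k + e) (f x) (w \<tau> k s t))"
  let ?SX = "simplicial_replacement omega (\<lambda>_. X)" and ?aX = "simplicial_replacement_act (arrow_power a)"
  let ?SY = "simplicial_replacement omega (\<lambda>_. Y)"
  have fY: "f x \<in> topspace Y" if "x \<in> topspace X" for x
    using that f by (auto simp: continuous_map_def)
  have wsimplex: "w \<tau> k s t \<in> standard_simplex (level s k + e)"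
    and wzero: "\<And>i. i < level s 0 + d \<Longrightarrow> w \<tau> k s t i = 0"
    if "\<tau> \<in> {0..1}" "s \<in> nerve omega k" "t \<in> standard_simplex k" for \<tau> k s t
  proof -
    have le: "level s 0 \<le> level s i" "level s i \<le> level s k" if "i \<le> k" for i
      using level_mono[OF \<open>s \<in> nerve omega k\<close>] that by auto
    show "w \<tau> k s t \<in> standard_simplex (level s k + e)"
      unfolding w_def using that le de
      by (intro simplex_convex simplex_push_simplex) (fastforce simp: add.commute intro: add_mono)+
    fix i assume i: "i < level s 0 + d"
    have "simplex_push k (\<lambda>i. d + level s i) t i = 0" "simplex_push k (\<lambda>i. e + level s i) t i = 0"
      using le de i by (auto intro!: simplex_push_below[where l = "level s 0 + d"] simp: add.commute add_mono)
    then show "w \<tau> k s t i = 0" by (simp add: w_def)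
  qed
  have wcoords: "tele_coords Y (level s 0 + d) (level s k + e) y (w \<tau> k s t)"
    if "\<tau> \<in> {0..1}" "s \<in> nerve omega k" "t \<in> standard_simplex k" "y \<in> topspace Y" for \<tau> k s t y
    using wsimplex wzero that level_mono[OF that(2), of 0 k] de by (simp add: tele_coords_def)
  obtain L where L: "continuous_map (prod_topology unit_interval (telescope X a)) (telescope Y b) L"
    and LK: "\<And>\<tau> z. \<lbrakk>\<tau> \<in> {0..1}; z \<in> topspace (realization_total ?SX)\<rbrakk> \<Longrightarrow> L (\<tau>, cell_point X a z) = K \<tau> z"
    unfolding hocolim_def[of omega "\<lambda>_. X"]
  proof (rule realization_homotopy[of ?SX "telescope Y b" K ?aX])
    fix k
    let ?D = "simplex_space k"
    show "continuous_map (prod_topology unit_interval (prod_topology (?SX k) ?D)) (telescope Y b)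
        (\<lambda>(\<tau>, xt). K \<tau> (k, xt))"
      unfolding simplicial_replacement_def
    \<comment> \<open>On the summand of a fixed \<open>s\<close> the target cell is fixed too; only
      the measure and the point of \<open>Y\<close> vary.\<close>
    proof (rule continuous_map_from_prod_sum_middle)
      fix s assume s: "s \<in> nerve omega k"
      let ?P = "prod_topology unit_interval ?D" and ?l = "level s 0 + d" and ?M = "level s k + e"
      let ?N = "?M - ?l" and ?Q = "prod_topology (prod_topology unit_interval ?D) X"
      have lM: "?l \<le> ?M" using level_mono[OF s, of 0 k] de by simp
      have c: "chain ?N (\<lambda>i. ?l + i) \<in> nerve omega ?N" by (rule chain_in_nerve[OF mono_add])
      have fstP: "continuous_map ?P euclideanreal fst"
        using continuous_map_fst[of unit_interval ?D] unfolding continuous_map_in_subtopology by blast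
      have "continuous_map ?P (simplex_space ?N) (\<lambda>z. \<lambda>j. w (fst z) k s (snd z) (?l + j))"
      proof (rule continuous_map_into_simplex_space)
        fix j
        show "continuous_map ?P euclideanreal (\<lambda>z. w (fst z) k s (snd z) (?l + j))"
          unfolding w_def using fstP
          by (intro continuous_intros continuous_map_simplex_push continuous_map_snd) auto
      next
        fix z assume "z \<in> topspace ?P"
        then have z: "fst z \<in> {0..1}" "snd z \<in> standard_simplex k"
          by (auto simp: simplex_space_def topspace_standard_simplex)
        then show "(\<lambda>j. w (fst z) k s (snd z) (?l + j)) \<in> standard_simplex ?N"
          using lM wsimplex[OF _ s] wzero[OF _ s] by (intro simplex_shift_simplex) auto
      qed
      from continuous_map_compose[OF continuous_map_fst this]
      have 1: "continuous_map ?Q (simplex_space ?N) (\<lambda>z. \<lambda>j. w (fst (fst z)) k s (snd (fst z)) (?l + j))"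
        by (simp add: o_def)
      have "continuous_map Y (?SY ?N) (Pair (chain ?N (\<lambda>i. ?l + i)))"
        unfolding simplicial_replacement_def by (rule continuous_map_component_injection[OF c])
      from continuous_map_compose[OF continuous_map_compose[OF continuous_map_snd f] this]
      have "continuous_map ?Q (?SY ?N) (\<lambda>z. (chain ?N (\<lambda>i. ?l + i), f (snd z)))"
        by (simp add: o_def)
      from continuous_map_pairedI[OF this 1]
      have 2: "continuous_map ?Q (prod_topology (?SY ?N) (simplex_space ?N))
          (\<lambda>z. ((chain ?N (\<lambda>i. ?l + i), f (snd z)), \<lambda>j. w (fst (fst z)) k s (snd (fst z)) (?l + j)))" .
      have "continuous_map (prod_topology (?SY ?N) (simplex_space ?N)) (realization_total ?SY) (Pair ?N)"
        unfolding realization_total_def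
        by (rule continuous_map_component_injection[where X = "\<lambda>n. prod_topology (?SY n) (simplex_space n)"]) simp
      from continuous_map_compose[OF continuous_map_compose[OF 2 this]
          quotient_imp_continuous_map[OF quotient_map_realization_point]]
      show "continuous_map ?Q (telescope Y b) (\<lambda>((\<tau>, t), x). (\<lambda>(\<tau>, xt). K \<tau> (k, xt)) (\<tau>, ((s, x), t)))"
        by (simp add: K_def tele_point_def hocolim_def o_def split_def)
    qed
  next
    fix \<tau> :: real and m n :: nat and \<theta> sx t
    assume \<tau>: "\<tau> \<in> {0..1}" and \<theta>: "mono_on {..m} \<theta>" "\<theta> ` {..m} \<subseteq> {..n}"
      and sx: "sx \<in> topspace (?SX n)" and t: "t \<in> standard_simplex m"
    obtain s x where [simp]: "sx = (s, x)" by (cases sx)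
    have s: "s \<in> nerve omega n" and x: "x \<in> topspace X"
      using sx by (auto simp: topspace_simplicial_replacement)
    let ?s = "nerve_act m \<theta> s" and ?r = "level s (\<theta> 0) - level s 0"
    have s': "?s \<in> nerve omega m" by (rule nerve_act_in_nerve[OF \<theta> s])
    have lev: "level ?s i = level s (\<theta> i)" if "i \<le> m" for i by (rule level_act[OF \<theta> s that])
    have \<theta>n: "\<theta> i \<le> n" if "i \<le> m" for i using \<theta> that by auto
    have push: "simplex_push m (\<lambda>i. c + level ?s i) t = simplex_push n (\<lambda>i. c + level s i) (simplex_push m \<theta> t)" for c
      unfolding simplex_push_compose[OF \<theta>(2)]
      using lev by (intro fun_cong[OF simplex_push_cong]) auto
    have weq: "w \<tau> n s (simplex_push m \<theta> t) = w \<tau> m ?s t"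
      by (simp add: w_def push)
    have ax: "(a ^^ r) x \<in> topspace X \<and> f ((a ^^ r) x) = (b ^^ r) (f x)" for r
    proof (induction r)
      case (Suc r)
      have "a ((a ^^ r) x) \<in> topspace X" using Suc a by (auto simp: continuous_map_def)
      then show ?case using Suc comm by simp
    qed (use x in simp)
    have act: "?aX m \<theta> (s, x) = (?s, (a ^^ ?r) x)"
      using chain_act[OF \<theta>, of a "level s" x] in_nerveD(2)[OF s]
      by (simp add: simplicial_replacement_act_def)
    have l1: "level s (\<theta> 0) \<ge> level s 0" "level s (\<theta> m) \<le> level s n"
      using level_mono[OF s] \<theta>n by auto
    have coords: "tele_coords Y (level ?s 0 + d) (level ?s m + e) (f ((a ^^ ?r) x)) (w \<tau> m ?s t)"
      using wcoords[OF \<tau> s' t] fY ax by blast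
    have coords': "tele_coords Y (level s 0 + d) (level s n + e) (f x) (w \<tau> m ?s t)"
      using wcoords[OF \<tau> s simplex_push_simplex[OF t \<theta>(2)] fY[OF x]] by (simp add: weq)
    \<comment> \<open>The operator may raise the first level, which applies a power of
      \<open>a\<close>, and lower the last one; \<open>tele_point_bound\<close> and
      \<open>tele_point_slide\<close> undo these two changes.\<close>
    have "K \<tau> (m, (?aX m \<theta> (s, x), t)) =
        tele_point Y b (level s (\<theta> 0) + d) (level s (\<theta> m) + e) ((b ^^ ?r) (f x)) (w \<tau> m ?s t)"
      using ax by (simp add: K_def act lev)
    also have "\<dots> = tele_point Y b (level s (\<theta> 0) + d) (level s n + e) ((b ^^ ?r) (f x)) (w \<tau> m ?s t)"
      using coords l1 ax by (intro tele_point_bound) (simp_all add: lev)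
    also have "\<dots> = tele_point Y b (level s 0 + d) (level s n + e) (f x) (w \<tau> m ?s t)"
      using tele_point_slide[OF coords', of "level s (\<theta> 0) + d" b] l1 coords
        level_mono[OF s, of "\<theta> 0" n] \<theta>n[of 0] de
      by (simp add: tele_coords_def lev)
    also have "\<dots> = K \<tau> (n, ((s, x), simplex_push m \<theta> t))"
      by (simp add: K_def weq)
    finally show "K \<tau> (m, (?aX m \<theta> sx, t)) = K \<tau> (n, (sx, simplex_push m \<theta> t))" by simp
  qed blast
  show thesis
  proof (rule that[OF L])
    fix \<tau> :: real and l M x \<mu>
    assume \<tau>: "\<tau> \<in> {0..1}" and co: "tele_coords X l M x \<mu>"
    then have l: "l \<le> M" "x \<in> topspace X" "\<mu> \<in> standard_simplex M" "\<And>i. i < l \<Longrightarrow> \<mu> i = 0"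
      by (auto simp: tele_coords_def)
    let ?k = "M - l" and ?c = "chain (M - l) (\<lambda>i. l + i)" and ?t = "\<lambda>j. \<mu> (l + j)"
    have t: "?t \<in> standard_simplex ?k" using l by (intro simplex_shift_simplex) auto
    have "simplex_push ?k (\<lambda>i. c + level ?c i) ?t = shift_measure c \<mu>" for c
    proof -
      have "simplex_push ?k (\<lambda>i. c + level ?c i) ?t = simplex_push ?k (\<lambda>i. (c + l) + i) ?t"
        by (intro fun_cong[OF simplex_push_cong]) simp
      also have "\<dots> = shift_measure c \<mu>"
        unfolding simplex_push_shift[OF t] shift_measure_def using l(4) by (auto simp: fun_eq_iff)
      finally show ?thesis .
    qed
    moreover have "(?k, ((?c, x), ?t)) \<in> topspace (realization_total ?SX)"
      using l t by (simp add: topspace_realization_total topspace_simplicial_replacement chain_in_nerve mono_add)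
    ultimately show "L (\<tau>, tele_point X a l M x \<mu>) =
      tele_point Y b (l + d) (M + e) (f x) (\<lambda>i. (1 - \<tau>) * shift_measure d \<mu> i + \<tau> * shift_measure e \<mu> i)"
      using LK[OF \<tau>, of "(?k, ((?c, x), ?t))"] l(1)
      by (simp add: K_def w_def tele_point_def[of X])
  qed
qed

text \<open>Interpolate from \<open>\<mu>\<close> to its shift while \<open>x\<close> stays at level
  \<open>l\<close>. At the end level \<open>l\<close> carries no mass, so \<open>x\<close> at level
  \<open>l\<close> can be slid to \<open>a x\<close> at level \<open>l + 1\<close>, which gives the
  value of \<open>\<Phi>\<close>.\<close>

lemma telescope_shift_homotopic_id:
  assumes a: "continuous_map X X a"
    and \<Phi>: "\<And>l M x \<mu>. tele_coords X l M x \<mu> \<Longrightarrow>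
      \<Phi> (tele_point X a l M x \<mu>) = tele_point X a (l + 1) (M + 1) (a x) (shift_measure 1 \<mu>)"
  shows "homotopic_with (\<lambda>_. True) (telescope X a) (telescope X a) \<Phi> id"
proof -
  obtain L where L: "continuous_map (prod_topology unit_interval (telescope X a)) (telescope X a) L"
    and Lpt: "\<And>\<tau> l M x \<mu>. \<lbrakk>\<tau> \<in> {0..1}; tele_coords X l M x \<mu>\<rbrakk> \<Longrightarrow> L (\<tau>, tele_point X a l M x \<mu>) =
      tele_point X a (l + 0) (M + 1) (id x) (\<lambda>i. (1 - \<tau>) * shift_measure 0 \<mu> i + \<tau> * shift_measure 1 \<mu> i)"
    by (rule telescope_homotopy[OF a continuous_map_id, of a 0 1]) auto
  have "homotopic_with (\<lambda>_. True) (telescope X a) (telescope X a) id \<Phi>"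
  proof (rule iffD2[OF homotopic_with], simp, intro exI conjI ballI)
    show "continuous_map (prod_topology unit_interval (telescope X a)) (telescope X a) L" by (rule L)
    fix y assume "y \<in> topspace (telescope X a)"
    then obtain l M x \<mu> where co: "tele_coords X l M x \<mu>" and y: "y = tele_point X a l M x \<mu>"
      by (rule tele_point_cases)
    have x: "x \<in> topspace X" and lM: "l \<le> M" and \<mu>: "\<mu> \<in> standard_simplex M" "\<forall>i<l. \<mu> i = 0"
      using co by (auto simp: tele_coords_def)
    show "L (0, y) = id y"
      using Lpt[OF _ co, of 0] tele_point_bound[OF co, of "M + 1" a] by (simp add: y)
    have co': "tele_coords X (l + 1) (M + 1) x (shift_measure 1 \<mu>)"
      using tele_coords_shift[OF co x] .
    then have "tele_coords X l (M + 1) x (shift_measure 1 \<mu>)"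
      by (simp add: tele_coords_def)
    from tele_point_slide[OF this, of "l + 1" a] co'
    show "L (1, y) = \<Phi> y"
      using Lpt[OF _ co, of 1] \<Phi>[OF co] by (simp add: y tele_coords_def)
  qed simp
  then show ?thesis by (rule homotopic_with_symD)
qed

lemma telescope_map:
  assumes a: "continuous_map X X a" and f: "continuous_map X Y f"
    and comm: "\<And>x. x \<in> topspace X \<Longrightarrow> f (a x) = b (f x)"
  obtains J where "continuous_map (telescope X a) (telescope Y b) J"
    "\<And>l M x \<mu>. tele_coords X l M x \<mu> \<Longrightarrow>
      J (tele_point X a l M x \<mu>) = tele_point Y b (l + d) (M + d) (f x) (shift_measure d \<mu>)"
proof -
  obtain L where L: "continuous_map (prod_topology unit_interval (telescope X a)) (telescope Y b) L"
    and Lpt: "\<And>\<tau> l M x \<mu>. \<lbrakk>\<tau> \<in> {0..1}; tele_coords X l M x \<mu>\<rbrakk> \<Longrightarrow> L (\<tau>, tele_point X a l M x \<mu>) =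
      tele_point Y b (l + d) (M + d) (f x) (\<lambda>i. (1 - \<tau>) * shift_measure d \<mu> i + \<tau> * shift_measure d \<mu> i)"
    by (rule telescope_homotopy[OF a f comm order_refl, of d]) auto
  show thesis
  proof (rule that)
    have "continuous_map (telescope X a) (prod_topology unit_interval (telescope X a)) (Pair 0)"
      by (intro continuous_map_pairedI) auto
    from continuous_map_compose[OF this L]
    show "continuous_map (telescope X a) (telescope Y b) (L \<circ> Pair 0)" .
  qed (use Lpt[of 0] in simp)
qed

text \<open>\<open>J\<close> keeps the levels, whereas \<open>G\<close> raises them by one. With
  that raise both composites have exactly the form of \<open>\<Phi>\<close> in
  \<open>telescope_shift_homotopic_id\<close>; without it they would merely apply
  \<open>r \<circ> i\<close> and \<open>i \<circ> r\<close> level by level.\<close>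

lemma telescope_interleaving:
  assumes i: "continuous_map X Y i" and r: "continuous_map Y X r"
  obtains J G where
    "continuous_map (telescope X (r \<circ> i)) (telescope Y (i \<circ> r)) J"
    "continuous_map (telescope Y (i \<circ> r)) (telescope X (r \<circ> i)) G"
    "homotopic_with (\<lambda>_. True) (telescope X (r \<circ> i)) (telescope X (r \<circ> i)) (G \<circ> J) id"
    "homotopic_with (\<lambda>_. True) (telescope Y (i \<circ> r)) (telescope Y (i \<circ> r)) (J \<circ> G) id"
    "\<And>l M x \<mu>. tele_coords X l M x \<mu> \<Longrightarrow>
      J (tele_point X (r \<circ> i) l M x \<mu>) = tele_point Y (i \<circ> r) l M (i x) \<mu>"
proof -
  have a: "continuous_map X X (r \<circ> i)" and b: "continuous_map Y Y (i \<circ> r)"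
    using i r continuous_map_compose by blast+
  have iY: "i x \<in> topspace Y" if "x \<in> topspace X" for x
    using that i by (auto simp: continuous_map_def)
  have rX: "r y \<in> topspace X" if "y \<in> topspace Y" for y
    using that r by (auto simp: continuous_map_def)
  obtain J where J: "continuous_map (telescope X (r \<circ> i)) (telescope Y (i \<circ> r)) J"
    and Jpt: "\<And>l M x \<mu>. tele_coords X l M x \<mu> \<Longrightarrow>
      J (tele_point X (r \<circ> i) l M x \<mu>) = tele_point Y (i \<circ> r) (l + 0) (M + 0) (i x) (shift_measure 0 \<mu>)"
    by (rule telescope_map[OF a i, of "i \<circ> r" 0]) auto
  obtain G where G: "continuous_map (telescope Y (i \<circ> r)) (telescope X (r \<circ> i)) G"
    and Gpt: "\<And>l M x \<mu>. tele_coords Y l M x \<mu> \<Longrightarrow>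
      G (tele_point Y (i \<circ> r) l M x \<mu>) = tele_point X (r \<circ> i) (l + 1) (M + 1) (r x) (shift_measure 1 \<mu>)"
    by (rule telescope_map[OF b r, of "r \<circ> i" 1]) auto
  have coY: "tele_coords Y l M (i x) \<mu>" if "tele_coords X l M x \<mu>" for l M x \<mu>
    using that iY by (auto simp: tele_coords_def)
  show thesis
  proof (rule that[OF J G])
    show "homotopic_with (\<lambda>_. True) (telescope X (r \<circ> i)) (telescope X (r \<circ> i)) (G \<circ> J) id"
    proof (rule telescope_shift_homotopic_id[OF a])
      fix l M x \<mu> assume co: "tele_coords X l M x \<mu>"
      show "(G \<circ> J) (tele_point X (r \<circ> i) l M x \<mu>) =
          tele_point X (r \<circ> i) (l + 1) (M + 1) ((r \<circ> i) x) (shift_measure 1 \<mu>)"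
        using Jpt[OF co] Gpt[OF coY[OF co]] by simp
    qed
    show "homotopic_with (\<lambda>_. True) (telescope Y (i \<circ> r)) (telescope Y (i \<circ> r)) (J \<circ> G) id"
    proof (rule telescope_shift_homotopic_id[OF b])
      fix l M y \<mu> assume co: "tele_coords Y l M y \<mu>"
      then have "tele_coords X (l + 1) (M + 1) (r y) (shift_measure 1 \<mu>)"
        using rX by (intro tele_coords_shift) (auto simp: tele_coords_def)
      from Jpt[OF this] Gpt[OF co]
      show "(J \<circ> G) (tele_point Y (i \<circ> r) l M y \<mu>) =
          tele_point Y (i \<circ> r) (l + 1) (M + 1) ((i \<circ> r) y) (shift_measure 1 \<mu>)"
        by simp
    qed
  qed (use Jpt in simp)
qed

section \<open>The structure map at level zero\<close>

definition base_point :: "nat \<Rightarrow> real" where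
  "base_point = (\<lambda>j. if j = 0 then 1 else 0)"

lemma tele_coords_base: "x \<in> topspace X \<Longrightarrow> tele_coords X 0 0 x base_point"
  by (simp add: tele_coords_def base_point_def)

lemma hocolim_structure_map_omega:
  "hocolim_structure_map omega (\<lambda>_. X) (arrow_power a) (code (0, 0)) x = tele_point X a 0 0 x base_point"
proof -
  have "chain 0 (\<lambda>i. i) = restrict (\<lambda>_. code (0, 0)) {(0, 0)}"
    by (auto simp: chain_def restrict_def fun_eq_iff)
  then show ?thesis
    by (simp add: hocolim_structure_map_def tele_point_def realization_point_def base_point_def)
qed

lemma continuous_map_structure_map_omega:
  "continuous_map X (telescope X a) (hocolim_structure_map omega (\<lambda>_. X) (arrow_power a) (code (0, 0)))"
proof -
  let ?S = "simplicial_replacement omega (\<lambda>_. X)" and ?c = "chain 0 (\<lambda>i. i)"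
  have "?c \<in> nerve omega 0" by (rule chain_in_nerve) (simp add: mono_onI)
  then have "continuous_map X (?S 0) (Pair ?c)"
    unfolding simplicial_replacement_def by (rule continuous_map_component_injection)
  moreover have "continuous_map X (simplex_space 0) (\<lambda>_. base_point)"
    by (simp add: simplex_space_def topspace_standard_simplex base_point_def)
  ultimately have 1: "continuous_map X (prod_topology (?S 0) (simplex_space 0)) (\<lambda>x. ((?c, x), base_point))"
    by (intro continuous_map_pairedI)
  have "continuous_map (prod_topology (?S 0) (simplex_space 0)) (realization_total ?S) (Pair 0)"
    unfolding realization_total_def
    by (rule continuous_map_component_injection[where X = "\<lambda>n. prod_topology (?S n) (simplex_space n)"]) simp
  from continuous_map_compose[OF continuous_map_compose[OF 1 this]
      quotient_imp_continuous_map[OF quotient_map_realization_point]]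
  have "continuous_map X (telescope X a) (\<lambda>x. tele_point X a 0 0 x base_point)"
    by (simp add: tele_point_def hocolim_def o_def)
  then show ?thesis by (simp add: hocolim_structure_map_omega[abs_def])
qed

end

section \<open>Two-out-of-six for a map and an inverse up to the class\<close>

context saturated_class
begin

lemma member_homeomorphism:
  assumes "homeomorphic_maps X X' \<phi> \<phi>'" "topspace X' \<lesssim> (UNIV :: 'u set)"
  shows "member X X' \<phi>"
proof (rule member_deformation_retraction(1)[where r = \<phi>'])
  show "homotopic_with (\<lambda>_. True) X' X' id (\<phi> \<circ> \<phi>')"
    using assms(1)
    by (intro homotopic_with_symD[OF homotopic_with_id2]) (auto simp: homeomorphic_maps_def)
qed (use assms in \<open>auto simp: homeomorphic_maps_def\<close>)

text \<open>The structure maps at level \<open>0\<close> are natural: \<open>J\<close> after that of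
  \<open>X\<close> equals that of \<open>Y\<close> after \<open>i\<close>. Both structure maps and
  \<open>J\<close> are in the class, so \<open>i\<close> follows by cancellation. The spaces are
  over \<open>'u\<close> because axiom (4) takes only such diagrams.\<close>

lemma two_of_six_universe:
  fixes X Y :: "'u topology"
  assumes i: "continuous_map X Y i" and r: "continuous_map Y X r"
    and ri: "member X X (r \<circ> i)" and ir: "member Y Y (i \<circ> r)"
  shows "member X Y i"
proof -
  have "(UNIV :: (nat \<times> nat) set) \<lesssim> (UNIV :: nat set)"
    by (metis UNIV_I UNIV_Times_UNIV inj_on_def lepoll_def prod_encode_eq subset_UNIV)
  also have "\<dots> \<lesssim> (UNIV :: 'u set)"
    using infinite_universe infinite_le_lepoll by blast
  finally obtain code :: "nat \<times> nat \<Rightarrow> 'u" where "inj code" unfolding lepoll_def by blast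
  then interpret omega_code code by unfold_locales
  have powr: "member Z Z (a ^^ n)" if "member Z Z a" for Z :: "'u topology" and a n
  proof (induction n)
    case 0
    then show ?case using member_id[OF memberD(2)[OF that]] by (simp add: id_def)
  next
    case (Suc n)
    then show ?case using member_compose[OF Suc that] by (simp add: o_def)
  qed
  have str: "member Z (telescope Z a) (hocolim_structure_map omega (\<lambda>_. Z) (arrow_power a) (code (0, 0)))"
    if a: "member Z Z a" for Z :: "'u topology" and a
  proof -
    have "H Z Z (a ^^ n)" for n
      using powr[OF a, of n] member_iff[of Z Z "a ^^ n" Z id id Z id id] memberD(1)
      by (auto simp: homeomorphic_maps_id)
    then have "\<forall>f\<in>Ar omega. H Z Z (arrow_power a f)" by (simp add: arrow_power_def)
    then have "in_class H Z (telescope Z a) (hocolim_structure_map omega (\<lambda>_. Z) (arrow_power a) (code (0, 0)))"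
      by (intro homotopy_colimits[OF category_omega diagram_omega[OF memberD(1)[OF a]]
            nonempty_classifying_space_omega contractible_classifying_space_omega]) auto
    then show ?thesis
      using continuous_map_structure_map_omega by (simp add: member_def)
  qed
  obtain J G where J: "continuous_map (telescope X (r \<circ> i)) (telescope Y (i \<circ> r)) J"
    and G: "continuous_map (telescope Y (i \<circ> r)) (telescope X (r \<circ> i)) G"
    and GJ: "homotopic_with (\<lambda>_. True) (telescope X (r \<circ> i)) (telescope X (r \<circ> i)) (G \<circ> J) id"
    and JG: "homotopic_with (\<lambda>_. True) (telescope Y (i \<circ> r)) (telescope Y (i \<circ> r)) (J \<circ> G) id"
    and Jpt: "\<And>l M x \<mu>. tele_coords X l M x \<mu> \<Longrightarrow>
      J (tele_point X (r \<circ> i) l M x \<mu>) = tele_point Y (i \<circ> r) l M (i x) \<mu>"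
    by (rule telescope_interleaving[OF i r]) blast
  have "member (telescope X (r \<circ> i)) (telescope Y (i \<circ> r)) J"
    using member_homotopy_equivalence[OF J G GJ JG] memberD(3)[OF str[OF ri]] memberD(3)[OF str[OF ir]] by blast
  from member_compose[OF str[OF ri] this]
  have "member X (telescope Y (i \<circ> r)) (hocolim_structure_map omega (\<lambda>_. Y) (arrow_power (i \<circ> r)) (code (0, 0)) \<circ> i)"
    by (rule member_eq_on) (simp add: hocolim_structure_map_omega Jpt tele_coords_base)
  then show ?thesis
    by (rule member_cancel_left[OF i str[OF ir]])
qed

text \<open>Arbitrary point types are reached by conjugating with homeomorphisms onto copies, which
  are themselves in the class.\<close>

lemma two_of_six:
  assumes i: "continuous_map X Y i" and r: "continuous_map Y X r"
    and ri: "member X X (r \<circ> i)" and ir: "member Y Y (i \<circ> r)"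
  shows "member X Y i"
proof -
  obtain X' :: "'u topology" and \<phi> \<phi>' and Y' :: "'u topology" and \<psi> \<psi>'
    where X': "homeomorphic_maps X X' \<phi> \<phi>'" and Y': "homeomorphic_maps Y Y' \<psi> \<psi>'"
    using homeomorphic_copy_exists memberD(2)[OF ri] memberD(2)[OF ir] by metis
  have conts: "continuous_map X X' \<phi>" "continuous_map X' X \<phi>'" "continuous_map Y Y' \<psi>" "continuous_map Y' Y \<psi>'"
    and inv: "\<And>x. x \<in> topspace X \<Longrightarrow> \<phi>' (\<phi> x) = x" "\<And>y. y \<in> topspace Y \<Longrightarrow> \<psi>' (\<psi> y) = y"
    using X' Y' by (auto simp: homeomorphic_maps_def)
  have mem: "member X X' \<phi>" "member X' X \<phi>'" "member Y Y' \<psi>" "member Y' Y \<psi>'"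
    using member_homeomorphism[OF X'] member_homeomorphism[OF Y']
      member_homeomorphism[OF homeomorphic_maps_sym[THEN iffD1, OF X'] memberD(2)[OF ri]]
      member_homeomorphism[OF homeomorphic_maps_sym[THEN iffD1, OF Y'] memberD(2)[OF ir]]
      subset_imp_lepoll[OF subset_UNIV] by blast+
  let ?i = "\<psi> \<circ> i \<circ> \<phi>'" and ?r = "\<phi> \<circ> r \<circ> \<psi>'"
  have pts: "\<phi>' x \<in> topspace X" "i (\<phi>' x) \<in> topspace Y" if "x \<in> topspace X'" for x
    using that conts i by (auto simp: continuous_map_def)
  have pts': "\<psi>' y \<in> topspace Y" "r (\<psi>' y) \<in> topspace X" if "y \<in> topspace Y'" for y
    using that conts r by (auto simp: continuous_map_def)
  have "member X' Y' ?i"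
  proof (rule two_of_six_universe[where r = ?r])
    show "continuous_map X' Y' ?i" "continuous_map Y' X' ?r"
      using conts i r by (auto intro: continuous_map_compose)
    have "member X' X' (\<phi> \<circ> (r \<circ> i) \<circ> \<phi>')"
      using member_compose[OF mem(2) member_compose[OF ri mem(1)]] by (simp add: o_assoc)
    then show "member X' X' (?r \<circ> ?i)"
      by (rule member_eq_on) (simp add: pts inv)
    have "member Y' Y' (\<psi> \<circ> (i \<circ> r) \<circ> \<psi>')"
      using member_compose[OF mem(4) member_compose[OF ir mem(3)]] by (simp add: o_assoc)
    then show "member Y' Y' (?i \<circ> ?r)"
      by (rule member_eq_on) (simp add: pts' inv)
  qed
  from member_compose[OF mem(1) member_compose[OF this mem(4)]]
  show ?thesis
    by (rule member_eq_on) (use i in \<open>auto simp: inv continuous_map_def Pi_iff\<close>)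
qed

end

section \<open>Fibrations over discs\<close>

definition segment :: "(nat \<Rightarrow> real) \<Rightarrow> (nat \<Rightarrow> real) \<Rightarrow> real \<Rightarrow> nat \<Rightarrow> real" where
  "segment x y s = (\<lambda>i. (1 - s) * x i + s * y i)"

lemma segment_simps [simp]: "segment x y 0 = x" "segment x y 1 = y" "segment x x = (\<lambda>_. x)"
  by (auto simp: segment_def algebra_simps)

lemma topspace_disc: "topspace (disc n) = {x. (\<forall>i\<ge>n. x i = 0) \<and> (\<Sum>i<n. (x i)\<^sup>2) \<le> 1}"
  by (auto simp: disc_def topspace_Euclidean_space)

lemma segment_in_disc:
  assumes "x \<in> topspace (disc n)" "y \<in> topspace (disc n)" "s \<in> {0..1}"
  shows "segment x y s \<in> topspace (disc n)"
proof -
  have sq: "(segment x y s i)\<^sup>2 \<le> (1 - s) * (x i)\<^sup>2 + s * (y i)\<^sup>2" for i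
  proof -
    \<comment> \<open>The exact defect in the convexity of the square, whose sign is
      visible.\<close>
    have "(1 - s) * (x i)\<^sup>2 + s * (y i)\<^sup>2 - (segment x y s i)\<^sup>2 = s * (1 - s) * (x i - y i)\<^sup>2"
      by (simp add: segment_def power2_eq_square algebra_simps)
    also have "\<dots> \<ge> 0" using assms(3) by simp
    finally show ?thesis by simp
  qed
  have "(\<Sum>i<n. (segment x y s i)\<^sup>2) \<le> (1 - s) * (\<Sum>i<n. (x i)\<^sup>2) + s * (\<Sum>i<n. (y i)\<^sup>2)"
    unfolding sum_distrib_left sum.distrib[symmetric] by (rule sum_mono) (rule sq)
  also have "\<dots> \<le> 1"
    using assms by (intro convex_bound_le) (auto simp: topspace_disc)
  finally show ?thesis using assms by (simp add: topspace_disc segment_def)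
qed

lemma continuous_map_disc_segment:
  assumes "continuous_map Z (disc n) f" "continuous_map Z (disc n) g" "continuous_map Z unit_interval s"
  shows "continuous_map Z (disc n) (\<lambda>z. segment (f z) (g z) (s z))"
proof -
  have coord: "continuous_map Z euclideanreal (\<lambda>z. h z i)" if "continuous_map Z (disc n) h" for h i
    using that unfolding disc_def Euclidean_space_def continuous_map_in_subtopology
      continuous_map_componentwise_UNIV by blast
  have s: "continuous_map Z euclideanreal s" "\<And>z. z \<in> topspace Z \<Longrightarrow> s z \<in> {0..1}"
    using assms(3) unfolding continuous_map_in_subtopology by auto
  have "continuous_map Z (powertop_real UNIV) (\<lambda>z. segment (f z) (g z) (s z))"
    unfolding segment_def continuous_map_componentwise_UNIV
    using s(1) coord assms(1,2) by (intro allI continuous_intros) auto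
  moreover have "segment (f z) (g z) (s z) \<in> topspace (disc n)" if "z \<in> topspace Z" for z
    using assms(1,2) s(2) that by (intro segment_in_disc) (auto simp: continuous_map_def)
  ultimately show ?thesis
    unfolding disc_def Euclidean_space_def
    by (intro continuous_map_into_subtopology) (auto simp: topspace_disc[unfolded disc_def])
qed

lemma continuous_map_lift:
  assumes l: "path_lifting_map P B q l"
    and e: "continuous_map Z P e" and \<gamma>: "continuous_map Z (path_space B) \<gamma>"
    and start: "\<And>z. z \<in> topspace Z \<Longrightarrow> q (e z) = \<gamma> z 0"
  shows "continuous_map Z P (\<lambda>z. l (e z, \<gamma> z))"
    and "z \<in> topspace Z \<Longrightarrow> q (l (e z, \<gamma> z)) = \<gamma> z 1"
proof -
  have dom: "continuous_map Z (path_lifting_domain P B q) (\<lambda>z. (e z, \<gamma> z))"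
    unfolding path_lifting_domain_def
    by (rule continuous_map_into_subtopology) (use e \<gamma> start in \<open>auto intro: continuous_map_pairedI\<close>)
  from continuous_map_compose[OF this] l
  show "continuous_map Z P (\<lambda>z. l (e z, \<gamma> z))"
    by (fastforce simp: path_lifting_map_def o_def)
  assume "z \<in> topspace Z"
  then have "(e z, \<gamma> z) \<in> topspace (path_lifting_domain P B q)"
    using dom by (auto simp: continuous_map_def)
  then show "q (l (e z, \<gamma> z)) = \<gamma> z 1"
    using l by (auto simp: path_lifting_map_def)
qed

lemma continuous_map_const_path:
  assumes "continuous_map Z B f"
  shows "continuous_map Z (path_space B) (\<lambda>z. const_path (f z))"
proof -
  have "continuous_map Z (path_space B) (\<lambda>z. \<lambda>s\<in>{0..1}. (f \<circ> snd) (s::real, z))"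
    by (intro continuous_map_path_space_curry continuous_map_compose[OF continuous_map_snd assms])
  then show ?thesis by (simp add: const_path_def)
qed

section \<open>Fibres and homotopy fibres over a disc\<close>

context saturated_class
begin

text \<open>The premise \<open>fibre_unit\<close> is stated separately because membership of the
  unit map of \<open>P\<close> does not by itself pass to its restriction to one fibre.\<close>

lemma fib_to_hofib_member:
  assumes q: "continuous_map P (disc n) q" and l: "path_lifting_map P (disc n) q l"
    and unit: "member P P (unit_map q l)" and b: "b \<in> topspace (disc n)"
    and fibre_unit: "member (fib P q b) (fib P q b) (\<lambda>e. l (e, const_path b))"
    and small: "topspace (hofib P (disc n) q b) \<lesssim> (UNIV :: 'u set)"
  shows "member (fib P q b) (hofib P (disc n) q b) (fib_to_hofib b)"
proof -
  let ?D = "disc n" and ?F = "fib P q b" and ?HF = "hofib P (disc n) q b"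
  let ?I = "prod_topology unit_interval"
  define r where "r = (\<lambda>e. l (e, \<lambda>s\<in>{0..1}. segment (q e) b s))"
  have qD: "q e \<in> topspace ?D" if "e \<in> topspace P" for e
    using that q by (auto simp: continuous_map_def)
  have incl: "continuous_map ?F P id"
    unfolding fib_def by (simp add: continuous_map_from_subtopology)
  have constb: "continuous_map Z ?D (\<lambda>_. b)" for Z :: "'z topology" using b by simp
  have qsnd: "continuous_map (?I P) ?D (\<lambda>z. q (snd z))"
    using continuous_map_compose[OF continuous_map_snd q] by (simp add: o_def)
  have line: "continuous_map P (path_space ?D) (\<lambda>e. \<lambda>s\<in>{0..1}. segment (q e) b s)"
    using continuous_map_path_space_curry[OF continuous_map_disc_segment[OF qsnd constb continuous_map_fst]]
    by simp
  have "continuous_map P P r" and qr: "\<And>e. e \<in> topspace P \<Longrightarrow> q (r e) = b"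
    unfolding r_def using continuous_map_lift[OF l continuous_map_id[unfolded id_def] line] by auto
  then have r: "continuous_map P ?F r"
    unfolding fib_def by (auto intro: continuous_map_into_subtopology)
  have "homotopic_with (\<lambda>_. True) P P (unit_map q l) r"
  proof (rule iffD2[OF homotopic_with], simp, intro exI conjI ballI)
    \<comment> \<open>The initial piece of the segment up to the current time is lifted: a constant
      path at time \<open>0\<close> gives the unit map, the full segment at time \<open>1\<close>
      gives \<open>r\<close>.\<close>
    let ?h = "\<lambda>z. l (snd z, \<lambda>s\<in>{0..1}. segment (q (snd z)) b (s * fst z))"
    have m: "continuous_map (?I (?I P)) unit_interval (\<lambda>y. fst y * fst (snd y))"
    proof -
      have "continuous_map (?I (?I P)) unit_interval fst" "continuous_map (?I (?I P)) unit_interval (fst \<circ> snd)"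
        by (blast intro: continuous_map_fst continuous_map_snd continuous_map_compose)+
      then show ?thesis
        unfolding continuous_map_in_subtopology
        by (auto simp: o_def intro!: continuous_map_real_mult mult_le_one)
    qed
    have "continuous_map (?I (?I P)) ?D (\<lambda>y. q (snd (snd y)))"
      using continuous_map_compose[OF continuous_map_snd qsnd] by (simp add: o_def)
    from continuous_map_path_space_curry[OF continuous_map_disc_segment[OF this constb m]]
    have "continuous_map (?I P) (path_space ?D) (\<lambda>z. \<lambda>s\<in>{0..1}. segment (q (snd z)) b (s * fst z))"
      by simp
    from continuous_map_lift(1)[OF l continuous_map_snd this]
    show "continuous_map (?I P) P ?h" by simp
    fix e assume "e \<in> topspace P"
    show "?h (0, e) = unit_map q l e" by (simp add: unit_map_def const_path_def)
    show "?h (1, e) = r e" by (simp add: r_def)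
  qed simp
  then have "member P P (id \<circ> r)" using member_homotopic unit by simp
  \<comment> \<open>The segment from \<open>b\<close> to \<open>b\<close> is constant, so
    \<open>r\<close> restricts to the unit map of the fibre.\<close>
  moreover have "member ?F ?F (r \<circ> id)"
    by (rule member_eq_on[OF fibre_unit]) (simp add: fib_def r_def const_path_def)
  ultimately have i: "member ?F P id"
    by (intro two_of_six[OF incl r])

  have inHF: "continuous_map Z ?HF h"
    if "continuous_map Z P (fst \<circ> h)" "continuous_map Z (path_space ?D) (snd \<circ> h)"
      "\<And>z. z \<in> topspace Z \<Longrightarrow> snd (h z) 0 = b \<and> snd (h z) 1 = q (fst (h z))"
    for Z :: "'z topology" and h
    unfolding hofib_def continuous_map_in_subtopology
    using that by (auto simp: continuous_map_pairwise split_def)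
  have HF1: "continuous_map ?HF P fst" and HF2: "continuous_map ?HF (path_space ?D) snd"
    unfolding hofib_def by (auto intro: continuous_map_from_subtopology continuous_map_fst continuous_map_snd)
  \<comment> \<open>Convexity of the disc supplies a continuous section of the projection from the
    homotopy fibre.\<close>
  define s where "s = (\<lambda>e. (e, \<lambda>t\<in>{0..1}. segment b (q e) t))"
  have s: "continuous_map P ?HF s"
  proof (rule inHF)
    show "continuous_map P (path_space ?D) (snd \<circ> s)"
      using continuous_map_path_space_curry[OF continuous_map_disc_segment[OF constb qsnd continuous_map_fst]]
      by (simp add: s_def o_def)
  qed (simp_all add: s_def o_def)
  have "homotopic_with (\<lambda>_. True) ?HF ?HF id (s \<circ> fst)"
  proof (rule iffD2[OF homotopic_with], simp, intro exI conjI ballI)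
    \<comment> \<open>The path is deformed pointwise to the straight one; both run from
      \<open>b\<close> to the image of the same point, so the deformation stays in the homotopy
      fibre.\<close>
    let ?h = "\<lambda>z. (fst (snd z), \<lambda>t\<in>{0..1}. segment (snd (snd z) t) (segment b (q (fst (snd z))) t) (fst z))"
    show "continuous_map (?I ?HF) ?HF ?h"
    proof (rule inHF)
      have e: "continuous_map (?I ?HF) P (\<lambda>z. fst (snd z))"
        using continuous_map_compose[OF continuous_map_snd HF1] by (simp add: o_def)
      then show "continuous_map (?I ?HF) P (fst \<circ> ?h)" by (simp add: o_def)
      let ?J = "?I (?I ?HF)"
      have t: "continuous_map ?J unit_interval fst" and \<tau>: "continuous_map ?J unit_interval (\<lambda>y. fst (snd y))"
        using continuous_map_compose[OF continuous_map_snd continuous_map_fst, of unit_interval unit_interval ?HF]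
        by (auto simp: o_def intro: continuous_map_fst)
      have "continuous_map ?J (path_space ?D) (\<lambda>y. snd (snd (snd y)))"
        using continuous_map_compose[OF continuous_map_compose[OF continuous_map_snd continuous_map_snd] HF2]
        by (simp add: o_def)
      from continuous_map_path_space_eval_compose[OF t this]
      have 1: "continuous_map ?J ?D (\<lambda>y. snd (snd (snd y)) (fst y))" .
      have "continuous_map ?J ?D (\<lambda>y. q (fst (snd (snd y))))"
        using continuous_map_compose[OF continuous_map_compose[OF continuous_map_snd e] q] by (simp add: o_def)
      from continuous_map_disc_segment[OF 1 continuous_map_disc_segment[OF constb this t] \<tau>]
      show "continuous_map (?I ?HF) (path_space ?D) (snd \<circ> ?h)"
        using continuous_map_path_space_curry by (fastforce simp: o_def)
    next
      fix z assume "z \<in> topspace (?I ?HF)"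
      then show "snd (?h z) 0 = b \<and> snd (?h z) 1 = q (fst (?h z))"
        by (auto simp: hofib_def)
    qed
    fix z assume z: "z \<in> topspace ?HF"
    obtain e \<gamma> where [simp]: "z = (e, \<gamma>)" by (cases z)
    have "\<gamma> \<in> extensional {0..1}"
      using z by (auto simp: hofib_def topspace_path_space paths_def)
    then have "restrict \<gamma> {0..1} = \<gamma>" by (rule extensional_restrict)
    then show "?h (0, z) = id z" by simp
    show "?h (1, z) = (s \<circ> fst) z" by (simp add: s_def)
  qed simp
  then have proj: "member ?HF P fst"
    using member_deformation_retraction(2)[OF s HF1 small] by (simp add: s_def)
  have "continuous_map ?F ?HF (fib_to_hofib b)"
  proof (rule inHF)
    show "continuous_map ?F P (fst \<circ> fib_to_hofib b)" using incl by (simp add: fib_to_hofib_def o_def id_def)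
    show "continuous_map ?F (path_space ?D) (snd \<circ> fib_to_hofib b)"
      using continuous_map_const_path[OF constb] by (simp add: fib_to_hofib_def o_def)
  qed (simp add: fib_to_hofib_def const_path_def fib_def)
  \<comment> \<open>The inclusion of the fibre into \<open>P\<close> is the projection after
    \<open>fib_to_hofib b\<close>; the inclusion and the projection are already in the
    class.\<close>
  then show ?thesis
    by (rule member_cancel_left[OF _ proj]) (use i in \<open>simp add: fib_to_hofib_def o_def id_def\<close>)
qed

lemma strong_imp_universal_H_fibration:
  fixes E B :: "'u topology"
  assumes "strong_H_fibration H E B p"
  shows "universal_H_fibration H E B p"
proof -
  obtain l where p: "continuous_map E B p" and l: "path_lifting_map E B p l"
    and univ: "\<And>n \<sigma>. continuous_map (disc n) B \<sigma> \<Longrightarrow>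
      H_path_lifting_map H (pullback (disc n) E \<sigma> p) (disc n) fst (induced_path_lifting \<sigma> l)"
    using assms unfolding strong_H_fibration_def universal_H_path_lifting_map_def by blast
  have fst: "continuous_map (pullback (disc n) E \<sigma> p) (disc n) fst" for n \<sigma>
    unfolding pullback_def by (intro continuous_map_from_subtopology continuous_map_fst)
  have snd: "continuous_map (pullback (disc n) E \<sigma> p) E snd" for n \<sigma>
    unfolding pullback_def by (intro continuous_map_from_subtopology continuous_map_snd)
  have lift: "path_lifting_map (pullback (disc n) E \<sigma> p) (disc n) fst (induced_path_lifting \<sigma> l)"
    and unit: "member (pullback (disc n) E \<sigma> p) (pullback (disc n) E \<sigma> p)
      (unit_map fst (induced_path_lifting \<sigma> l))" if \<sigma>: "continuous_map (disc n) B \<sigma>" for n \<sigma>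
  proof -
    show L: "path_lifting_map (pullback (disc n) E \<sigma> p) (disc n) fst (induced_path_lifting \<sigma> l)"
      using univ[OF \<sigma>] by (simp add: H_path_lifting_map_def)
    have "continuous_map (pullback (disc n) E \<sigma> p) (pullback (disc n) E \<sigma> p)
        (\<lambda>e. induced_path_lifting \<sigma> l (e, const_path (fst e)))"
      by (rule continuous_map_lift(1)[OF L continuous_map_id[unfolded id_def] continuous_map_const_path[OF fst]])
        (simp add: const_path_def)
    then show "member (pullback (disc n) E \<sigma> p) (pullback (disc n) E \<sigma> p)
      (unit_map fst (induced_path_lifting \<sigma> l))"
      using univ[OF \<sigma>] by (simp add: member_def H_path_lifting_map_def unit_map_def[abs_def])
  qed
  have real: "(UNIV :: real set) \<lesssim> (UNIV :: 'u set)"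
    by (rule real_lepoll_universe[OF infinite_universe universe_lepoll])
  have disc: "(UNIV :: (nat \<Rightarrow> real) set) \<lesssim> (UNIV :: 'u set)"
    by (rule lepoll_nat_fun_universe[OF universe_lepoll real])
  \<comment> \<open>The point type of the homotopy fibres of a pullback to a disc.\<close>
  have "(UNIV :: (((nat \<Rightarrow> real) \<times> 'u) \<times> (real \<Rightarrow> nat \<Rightarrow> real)) set) \<lesssim> (UNIV :: 'u set)"
    using lepoll_Times_universe[OF infinite_universe
        lepoll_Times_universe[OF infinite_universe disc lepoll_refl]
        lepoll_fun_universe[OF universe_lepoll disc]] by simp
  then have small: "A \<lesssim> (UNIV :: 'u set)" for A :: "(((nat \<Rightarrow> real) \<times> 'u) \<times> (real \<Rightarrow> nat \<Rightarrow> real)) set"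
    using lepoll_trans subset_imp_lepoll[OF subset_UNIV] by blast
  have "in_class H (fib (pullback (disc n) E \<sigma> p) fst b) (hofib (pullback (disc n) E \<sigma> p) (disc n) fst b) (fib_to_hofib b)"
    if \<sigma>: "continuous_map (disc n) B \<sigma>" and b: "b \<in> topspace (disc n)" for n \<sigma> b
  proof -
    \<comment> \<open>\<open>?\<sigma>0\<close> is the test map on the one-point disc whose pullback
      \<open>?P0\<close> is a copy of the fibre \<open>?F\<close>.\<close>
    let ?P = "pullback (disc n) E \<sigma> p" and ?\<sigma>0 = "\<lambda>_ :: nat \<Rightarrow> real. \<sigma> b"
    let ?F = "fib ?P fst b" and ?P0 = "pullback (disc 0) E ?\<sigma>0 p"
    let ?z = "\<lambda>_ :: nat. 0 :: real"
    let ?u0 = "unit_map fst (induced_path_lifting ?\<sigma>0 l)"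
    have \<sigma>b: "\<sigma> b \<in> topspace B" using \<sigma> b by (auto simp: continuous_map_def)
    have top0: "topspace (disc 0) = {?z}" by (auto simp: topspace_disc)
    have topF: "topspace ?F = {(c, e). c = b \<and> e \<in> topspace E \<and> \<sigma> b = p e}"
      using b by (auto simp: fib_def pullback_def)
    have topP0: "topspace ?P0 = {(c, e). c = ?z \<and> e \<in> topspace E \<and> \<sigma> b = p e}"
      using top0 by (auto simp: pullback_def)
    have u0: "member ?P0 ?P0 ?u0" using unit[of 0 ?\<sigma>0] \<sigma>b by simp
    have homeo: "homeomorphic_maps ?P0 ?F (\<lambda>(c, e). (b, e)) (\<lambda>(c, e). (?z, e))"
      unfolding homeomorphic_maps_def
    proof (intro conjI)
      have "continuous_map ?P0 (prod_topology (disc n) E) (\<lambda>z. (b, snd z))"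
        using b by (intro continuous_map_pairedI snd) simp
      then show "continuous_map ?P0 ?F (\<lambda>(c, e). (b, e))"
        unfolding fib_def pullback_def[of "disc n"] split_def
        by (intro continuous_map_into_subtopology) (auto simp: topP0)
      have "continuous_map ?F E snd"
        unfolding fib_def by (intro continuous_map_from_subtopology snd)
      then have "continuous_map ?F (prod_topology (disc 0) E) (\<lambda>z. (?z, snd z))"
        using top0 by (intro continuous_map_pairedI) auto
      then show "continuous_map ?F ?P0 (\<lambda>(c, e). (?z, e))"
        unfolding pullback_def[of "disc 0"] split_def
        by (intro continuous_map_into_subtopology) (auto simp: topF)
    qed (auto simp: topF topP0)
    have topF_small: "topspace ?F \<lesssim> (UNIV :: 'u set)"
      using homeomorphic_maps_map[THEN iffD1, OF homeo] memberD(2)[OF u0]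
      by (metis homeomorphic_eq_everything_map image_lepoll lepoll_trans)
    have "member ?F ?F ((\<lambda>(c, e). (b, e)) \<circ> (?u0 \<circ> (\<lambda>(c, e). (?z, e))))"
      using member_compose[OF member_compose[OF
            member_homeomorphism[OF homeomorphic_maps_sym[THEN iffD1, OF homeo] memberD(2)[OF u0]] u0]
          member_homeomorphism[OF homeo topF_small]] .
    \<comment> \<open>The unit map over \<open>disc 0\<close> and the lifting along
      \<open>const_path b\<close> over \<open>disc n\<close> both evaluate \<open>l\<close> at the
      constant path at \<open>\<sigma> b\<close>, so they agree under the identification of
      \<open>?P0\<close> with \<open>?F\<close>.\<close>
    then have "member ?F ?F (\<lambda>e. induced_path_lifting \<sigma> l (e, const_path b))"
      by (rule member_eq_on)
        (auto simp: topF unit_map_def induced_path_lifting_def const_path_def compose_def restrict_def cong: if_cong)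
    then show ?thesis
      using fib_to_hofib_member[OF fst lift[OF \<sigma>] unit[OF \<sigma>] b _ small] by (simp add: member_def)
  qed
  then show ?thesis
    unfolding universal_H_fibration_def H_fibration_def using p fst by blast
qed

end

theorem proposition8:
  fixes H :: "'u map_class" and E B :: "'u topology" and p :: "'u \<Rightarrow> 'u"
  assumes "infinite (UNIV :: 'u set)"
    and "(UNIV :: (real \<Rightarrow> 'u) set) \<lesssim> (UNIV :: 'u set)"
    and "class_of_maps H"
    and "two_out_of_three H"
    and "strong_H_fibration H E B p"
  shows "universal_H_fibration H E B p"
proof -
  interpret saturated_class H
    using assms(1-4) by (simp add: saturated_class_def saturated_class_axioms_def)
  show ?thesis using assms(5) by (rule strong_imp_universal_H_fibration)
qed

end
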